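(* Let $n\ge1$, $1<p<3$, $\rho\ge 1$, let $w$ be an $A_p$ weight on $\mathbb R^n$, and let $\mathcal S$ be a sparse collection of dyadic cubes in $\mathbb R^n$. Define, for locally integrable $f$, \[ T_{\mathcal S}f(x)=\Bigl(\sum_{Q\in\mathcal S}\langle f\rangle_{\rho Q}^2\,\mathbf 1_Q(x)\Bigr)^{1/2}. \] Then for every $f\in L^p(w)$, \[ \lVert T_{\mathcal S}f\rVert_{L^{p,\infty}(w)}\le C\,[w]_{A_p}^{\max\{\frac12,\frac1p\}}\,\phi([w]_{A_p})\,\lVert f\rVert_{L^p(w)}, \] where $\phi(x)=1$ if $1<p<2$ and $\phi(x)=1+\log x$ if $2\le p<3$, and $C$ depends only on $n,p,\rho$ (not on $w$, $\mathcal S$ or $f$).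
   Context: For $1<p<\infty$, a weight $w$ is in $A_p$ if $w$ has a density $w(x)>0$ a.e. and, with $\sigma(x)=w(x)^{1-\frac{p}{p-1}}$, $[w]_{A_p}:=\sup_Q \frac{w(Q)}{|Q|}\bigl(\frac{\sigma(Q)}{|Q|}\bigr)^{p-1}<\infty$, the supremum over all cubes $Q\subset\mathbb R^n$. $L^{p,\infty}(w)$ is weak $L^p$ with respect to $w\,dx$. For a cube $Q$ and $\rho>0$, $\rho Q$ is the cube with the same center as $Q$ and side length $\rho$ times that of $Q$; $\langle f\rangle_Q=|Q|^{-1}\int_Q f\,dx$. A collection $\mathcal S$ of dyadic cubes is sparse if for every $Q\in\mathcal S$, $\bigl|\bigcup\{Q'\in\mathcal S: Q'\subsetneq Q\}\bigr|<\tfrac12|Q|$. *)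

theory Defs
  imports "HOL-Analysis.Analysis"
begin

text \<open>Positive real powers of extended nonnegative reals (used with exponents a > 0):
  infinity stays infinity.\<close>
definition enn_powr :: "ennreal \<Rightarrow> real \<Rightarrow> ennreal" where
  "enn_powr x a = (if x = \<infinity> then \<infinity> else ennreal (enn2real x powr a))"

definition cube :: "real^'n \<Rightarrow> real \<Rightarrow> (real^'n) set" where
  "cube c l = {x. \<forall>i. c$i - l/2 \<le> x$i \<and> x$i < c$i + l/2}"

definition is_cube :: "(real^'n) set \<Rightarrow> bool" where
  "is_cube Q \<longleftrightarrow> (\<exists>c l. l > 0 \<and> Q = cube c l)"

definition dilate :: "real \<Rightarrow> (real^'n) set \<Rightarrow> (real^'n) set" where
  "dilate \<rho> Q = (SOME Q'. \<exists>c l. l > 0 \<and> Q = cube c l \<and> Q' = cube c (\<rho> * l))"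

text \<open>Standard dyadic cubes: products of intervals [m 2^-k, (m+1) 2^-k).\<close>
definition dyadic_cube :: "(real^'n) set \<Rightarrow> bool" where
  "dyadic_cube Q \<longleftrightarrow> (\<exists>(k::int) (m::'n \<Rightarrow> int).
     Q = cube (\<chi> i. (real_of_int (m i) + 1/2) * 2 powr (- real_of_int k)) (2 powr (- real_of_int k)))"

definition sparse :: "(real^'n) set set \<Rightarrow> bool" where
  "sparse S \<longleftrightarrow> (\<forall>Q\<in>S. dyadic_cube Q) \<and>
     (\<forall>Q\<in>S. measure lebesgue (\<Union>{Q'\<in>S. Q' \<subset> Q}) < measure lebesgue Q / 2)"

definition avg :: "(real^'n \<Rightarrow> real) \<Rightarrow> (real^'n) set \<Rightarrow> real" where
  "avg f A = (LINT y:A|lebesgue. f y) / measure lebesgue A"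

definition wmeas :: "(real^'n \<Rightarrow> real) \<Rightarrow> (real^'n) set \<Rightarrow> ennreal" where
  "wmeas w E = (\<integral>\<^sup>+x. indicator E x * ennreal (w x) \<partial>lebesgue)"

definition dual_weight :: "real \<Rightarrow> (real^'n \<Rightarrow> real) \<Rightarrow> real^'n \<Rightarrow> real" where
  "dual_weight p w x = w x powr (1 - p / (p - 1))"

definition Ap_char :: "real \<Rightarrow> (real^'n \<Rightarrow> real) \<Rightarrow> (real^'n) set \<Rightarrow> real" where
  "Ap_char p w Q = (enn2real (wmeas w Q) / measure lebesgue Q) *
      (enn2real (wmeas (dual_weight p w) Q) / measure lebesgue Q) powr (p - 1)"

definition Ap_weight :: "real \<Rightarrow> (real^'n \<Rightarrow> real) \<Rightarrow> bool" where
  "Ap_weight p w \<longleftrightarrow> w \<in> borel_measurable lebesgue \<and> (AE x in lebesgue. w x > 0) \<and>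
     (\<forall>Q. is_cube Q \<longrightarrow> wmeas w Q < \<infinity> \<and> wmeas (dual_weight p w) Q < \<infinity>) \<and>
     bdd_above (Ap_char p w ` {Q. is_cube Q})"

definition Ap_const :: "real \<Rightarrow> (real^'n \<Rightarrow> real) \<Rightarrow> real" where
  "Ap_const p w = (SUP Q\<in>{Q. is_cube Q}. Ap_char p w Q)"

definition in_Lp_w :: "real \<Rightarrow> (real^'n \<Rightarrow> real) \<Rightarrow> (real^'n \<Rightarrow> real) \<Rightarrow> bool" where
  "in_Lp_w p w f \<longleftrightarrow> f \<in> borel_measurable lebesgue \<and>
     (\<integral>\<^sup>+x. ennreal (\<bar>f x\<bar> powr p * w x) \<partial>lebesgue) < \<infinity>"

definition Lp_w_norm :: "real \<Rightarrow> (real^'n \<Rightarrow> real) \<Rightarrow> (real^'n \<Rightarrow> real) \<Rightarrow> real" where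
  "Lp_w_norm p w f = enn2real (\<integral>\<^sup>+x. ennreal (\<bar>f x\<bar> powr p * w x) \<partial>lebesgue) powr (1 / p)"

definition weak_Lp_w_norm :: "real \<Rightarrow> (real^'n \<Rightarrow> real) \<Rightarrow> (real^'n \<Rightarrow> ennreal) \<Rightarrow> ennreal" where
  "weak_Lp_w_norm p w g =
     (SUP t\<in>{0<..}. ennreal t * enn_powr (wmeas w {x. g x > ennreal t}) (1 / p))"

definition sparse_square :: "(real^'n) set set \<Rightarrow> real \<Rightarrow> (real^'n \<Rightarrow> real) \<Rightarrow> real^'n \<Rightarrow> ennreal" where
  "sparse_square S \<rho> f x =
     enn_powr (\<Sum>\<^sub>\<infinity>Q\<in>S. ennreal ((avg f (dilate \<rho> Q))\<^sup>2 * indicator Q x)) (1 / 2)"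

definition phi :: "real \<Rightarrow> real \<Rightarrow> real" where
  "phi p t = (if p < 2 then 1 else 1 + ln t)"

end

theory Submission
  imports Defs
begin

text \<open>
  By homogeneity it suffices to bound \<open>w {T f > 1}\<close>, and \<open>S\<close> may be taken finite. Let
  \<open>A\<close> be the \<open>A\<^sub>p\<close> constant and group the cubes by the dyadic size \<open>a\<close> of the average of
  \<open>\<bar>f\<bar>\<close> over \<open>\<rho> Q\<close>. Within one group, order the cubes by side length and remove from each
  \<open>\<rho> Q\<close> the points already covered by many smaller dilated cubes. Sparseness and Markov's inequality
  show that the remaining sets still carry half of the mass of \<open>\<bar>f\<bar>\<close>, and they have bounded overlap, so
  Hoelder's inequality gives \<open>\<Sum> w(Q) \<le> C A a\<^sup>-\<^sup>p \<parallel>f\<parallel>\<^sup>p\<close> for the group. Cubes with \<open>a > 1\<close> are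
  handled by the union bound. For \<open>p < 2\<close> the first moment of the remaining sum suffices. For
  \<open>p \<ge> 2\<close> it suffices when \<open>a\<^sup>2 A \<ge> 1\<close>, at the cost of a factor \<open>1 + log A\<close>. The groups with smaller \<open>a\<close>
  are summed in \<open>L\<^sup>2(w)\<close>, using the Carleson estimate
  \<open>\<Sum> {w(Q'). Q' \<subseteq> Q} \<le> C A w(Q)\<close>, which follows from the \<open>A\<^sub>p\<close> condition on the disjoint parts of
  the cubes not covered by smaller ones.
\<close>

section \<open>Cubes\<close>

text \<open>The two boxes have the same Lebesgue measure, which is therefore also that of the
  half-open cube between them.\<close>

lemma cube_sandwich:
  fixes c :: "real^'n"
  shows "box (\<chi> i. c$i - l/2) (\<chi> i. c$i + l/2) \<subseteq> cube c l"
    and "cube c l \<subseteq> cbox (\<chi> i. c$i - l/2) (\<chi> i. c$i + l/2)"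
  by (auto simp: cube_def mem_box_cart less_imp_le)

lemma cube_borel [measurable]: "cube c l \<in> sets borel"
proof -
  have "cube c l = (\<Inter>i. {x. c$i - l/2 \<le> x$i} \<inter> {x. x$i < c$i + l/2})"
    by (auto simp: cube_def)
  also have "\<dots> \<in> sets borel"
    by (intro sets.countable_INT' borel_closed borel_open sets.Int closed_halfspace_component_ge_cart
      open_halfspace_component_lt_cart) auto
  finally show ?thesis .
qed

lemma cube_lebesgue [measurable]: "cube c l \<in> sets lebesgue"
  using cube_borel by (metis borel_closed sets_completionI_sets sets_lborel)

lemma emeasure_cube:
  fixes c :: "real^'n"
  assumes "0 \<le> l"
  shows "emeasure lebesgue (cube c l) = ennreal (l ^ CARD('n))"
proof -
  let ?a = "(\<chi> i. c$i - l/2)::real^'n" and ?b = "(\<chi> i. c$i + l/2)::real^'n"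
  have le: "\<And>i. i \<in> Basis \<Longrightarrow> ?a \<bullet> i \<le> ?b \<bullet> i"
    using assms by (auto simp: Basis_vec_def inner_axis)
  have pr: "(\<Prod>i\<in>Basis. (?b - ?a) \<bullet> i) = l ^ CARD('n)"
  proof -
    have "(\<Prod>i\<in>Basis. (?b - ?a) \<bullet> i) = (\<Prod>i\<in>(Basis::(real^'n) set). l)"
      by (rule prod.cong) (auto simp: Basis_vec_def inner_axis)
    then show ?thesis by simp
  qed
  have "emeasure lborel (box ?a ?b) = ennreal (l ^ CARD('n))"
    using emeasure_lborel_box[OF le] pr by simp
  moreover have "emeasure lborel (cbox ?a ?b) = ennreal (l ^ CARD('n))"
    using emeasure_lborel_cbox[OF le] pr by simp
  ultimately have "emeasure lborel (cube c l) = ennreal (l ^ CARD('n))"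
    using cube_sandwich[of c l]
    by (intro antisym) (metis cube_borel emeasure_mono sets_lborel cbox_borel box_borel)+
  then show ?thesis by simp
qed

lemma measure_cube: "0 \<le> l \<Longrightarrow> measure lebesgue (cube (c :: real^'n) l) = l ^ CARD('n)"
  using emeasure_cube[of l c] unfolding measure_def by (metis enn2real_ennreal zero_le_power)

lemma lmeasurable_cube: "0 \<le> l \<Longrightarrow> cube (c :: real^'n) l \<in> lmeasurable"
  by (rule fmeasurableI[OF cube_lebesgue]) (metis emeasure_cube ennreal_less_top infinity_ennreal_def)

text \<open>Equal volumes give equal sides; half-open cubes contain their lower corners, and
  comparing these gives equal centres. This makes the choice in \<open>dilate\<close>
  unambiguous.\<close>

lemma cube_inject:
  fixes c c' :: "real^'n"
  assumes "cube c l = cube c' l'" "0 < l" "0 < l'"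
  shows "c = c'" "l = l'"
proof -
  have "l ^ CARD('n) = l' ^ CARD('n)"
    using assms measure_cube[of l c] measure_cube[of l' c'] by simp
  then show l: "l = l'" using assms by (metis less_imp_le power_eq_imp_eq_base zero_less_card_finite)
  have "(\<chi> i. c$i - l/2) \<in> cube c l" "(\<chi> i. c'$i - l'/2) \<in> cube c' l'"
    using assms(2,3) by (simp_all add: cube_def)
  then have "(\<chi> i. c$i - l/2) \<in> cube c' l'" "(\<chi> i. c'$i - l'/2) \<in> cube c l"
    using assms(1) by simp_all
  then show "c = c'" using l by (auto simp: cube_def vec_eq_iff intro!: antisym)
qed

lemma dilate_cube: "0 < l \<Longrightarrow> dilate \<rho> (cube c l) = cube c (\<rho> * l)"
  unfolding dilate_def by (rule some_equality) (auto dest: cube_inject)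

text \<open>At scale \<open>k\<close> a dyadic cube is a level set of the coordinatewise floor of
  \<open>x * 2 powr k\<close>, which turns nesting into integer arithmetic.\<close>

lemma dyadic_cube_mem_iff:
  fixes x :: "real^'n"
  shows "x \<in> cube (\<chi> i. (real_of_int (m i) + 1/2) * 2 powr (- real_of_int k)) (2 powr (- real_of_int k))
    \<longleftrightarrow> (\<forall>i. \<lfloor>x$i * 2 powr k\<rfloor> = m i)"
proof -
  have [simp]: "(2::real) powr (- real_of_int k) = 1 / 2 powr k" by (simp add: powr_minus divide_inverse)
  have "(m i + 1/2) * (1 / 2 powr k) - (1 / 2 powr k)/2 \<le> y \<and> y < (m i + 1/2) * (1/2 powr k) + (1/2 powr k)/2
    \<longleftrightarrow> \<lfloor>y * 2 powr k\<rfloor> = m i" for i and y :: real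
  proof -
    have p: "0 < (2::real) powr k" by simp
    have "(m i + 1/2) * (1 / 2 powr k) - (1 / 2 powr k)/2 = m i / 2 powr k"
      "(m i + 1/2) * (1/2 powr k) + (1/2 powr k)/2 = (m i + 1) / 2 powr k"
      by (simp_all add: field_simps)
    then show ?thesis using p by (simp add: floor_eq_iff divide_le_eq less_divide_eq)
  qed
  then show ?thesis by (simp add: cube_def)
qed

text \<open>Rounding at the coarse scale factors through rounding at the fine scale; dyadic nesting
  rests on this alone.\<close>

lemma floor_dyadic_coarsen:
  fixes x :: real and j k :: int
  assumes "j \<le> k"
  shows "\<lfloor>x * 2 powr j\<rfloor> = \<lfloor>x * 2 powr k\<rfloor> div 2 ^ nat (k - j)"
proof -
  have "real_of_int (2 ^ nat (k - j)) = 2 powr (k - j)"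
    using assms by (simp add: powr_realpow[symmetric])
  then have "x * 2 powr j = x * 2 powr k / real_of_int (2 ^ nat (k - j))"
    by (simp add: powr_diff)
  then show ?thesis by (metis floor_divide_real_eq_div zero_le_numeral zero_le_power)
qed

text \<open>Given a common point, the cube of larger \<open>k\<close> lies in the other one: equal
  fine indices force equal coarse indices.\<close>

lemma dyadic_cube_nested:
  assumes "dyadic_cube Q" "dyadic_cube Q'" "x \<in> Q" "x \<in> Q'"
  shows "Q \<subseteq> Q' \<or> Q' \<subseteq> Q"
proof -
  obtain k m where Q: "Q = cube (\<chi> i. (real_of_int (m i) + 1/2) * 2 powr (- real_of_int k)) (2 powr (- real_of_int k))"
    using assms(1) unfolding dyadic_cube_def by blast
  obtain k' m' where Q': "Q' = cube (\<chi> i. (real_of_int (m' i) + 1/2) * 2 powr (- real_of_int k')) (2 powr (- real_of_int k'))"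
    using assms(2) unfolding dyadic_cube_def by blast
  have m: "\<And>y. y \<in> Q \<longleftrightarrow> (\<forall>i. \<lfloor>y$i * 2 powr k\<rfloor> = m i)" "\<And>y. y \<in> Q' \<longleftrightarrow> (\<forall>i. \<lfloor>y$i * 2 powr k'\<rfloor> = m' i)"
    unfolding Q Q' by (rule dyadic_cube_mem_iff)+
  show ?thesis
  proof (cases "k \<le> k'")
    case True
    have "Q' \<subseteq> Q" using assms(3,4) unfolding subset_iff m by (metis floor_dyadic_coarsen[OF True])
    then show ?thesis ..
  next
    case False
    then have "k' \<le> k" by simp
    then have "Q \<subseteq> Q'" using assms(3,4) unfolding subset_iff m by (metis floor_dyadic_coarsen)
    then show ?thesis ..
  qed
qed

lemma countable_dyadic_cubes: "countable {Q :: (real^'n) set. dyadic_cube Q}"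
proof -
  have "{Q :: (real^'n) set. dyadic_cube Q} \<subseteq> (\<lambda>(k, m :: int^'n). cube (\<chi> i. (real_of_int (m$i) + 1/2) * 2 powr (- real_of_int k)) (2 powr (- real_of_int k))) ` UNIV"
  proof
    fix Q :: "(real^'n) set" assume "Q \<in> {Q. dyadic_cube Q}"
    then obtain k m where Q: "Q = cube (\<chi> i. (real_of_int (m i) + 1/2) * 2 powr (- real_of_int k)) (2 powr (- real_of_int k))"
      unfolding dyadic_cube_def by blast
    show "Q \<in> (\<lambda>(k, m :: int^'n). cube (\<chi> i. (real_of_int (m$i) + 1/2) * 2 powr (- real_of_int k)) (2 powr (- real_of_int k))) ` UNIV"
      unfolding Q by (rule image_eqI[where x="(k, \<chi> i. m i)"]) auto
  qed
  moreover have "countable (UNIV :: (int^'n) set)"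
  proof -
    have "countable (PiE (UNIV::'n set) (\<lambda>_. UNIV :: int set))" by (rule countable_PiE) auto
    then have "countable (range (\<lambda>f::'n \<Rightarrow> int. (\<chi> i. f i)))" by (simp add: PiE_UNIV_domain)
    moreover have "range (\<lambda>f::'n \<Rightarrow> int. (\<chi> i. f i)) = UNIV"
      by (metis (no_types, lifting) surjI vec_nth_inverse)
    ultimately show ?thesis by simp
  qed
  ultimately show ?thesis
    by (meson countable_SIGMA countable_image countable_subset countableI_type UNIV_Times_UNIV)
qed

section \<open>Centre and side length of a cube\<close>

definition center :: "(real^'n) set \<Rightarrow> real^'n" where
  "center Q = (SOME c. \<exists>l>0. Q = cube c l)"

definition side :: "(real^'n) set \<Rightarrow> real" where
  "side Q = (SOME l. \<exists>c. 0 < l \<and> Q = cube c l)"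

lemma center_side:
  assumes "is_cube Q" shows "0 < side Q" "Q = cube (center Q) (side Q)"
proof -
  obtain c l where cl: "0 < l" "Q = cube c l" using assms unfolding is_cube_def by blast
  have "side Q = l" "center Q = c" unfolding side_def center_def
    by (rule some_equality; use cl cube_inject in blast)+
  then show "0 < side Q" "Q = cube (center Q) (side Q)" using cl by auto
qed

lemma is_cube_dyadic: "dyadic_cube Q \<Longrightarrow> is_cube Q"
  unfolding dyadic_cube_def is_cube_def by (metis powr_gt_zero zero_less_numeral less_numeral_extra(3) zero_neq_numeral)

lemma dilate_eq: "is_cube Q \<Longrightarrow> dilate \<rho> Q = cube (center Q) (\<rho> * side Q)"
  using center_side dilate_cube by metis

section \<open>Hoelder's inequality and the weight class\<close>

text \<open>Young's inequality for the product of \<open>g w^(1/p)\<close> and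
  \<open>w^(-1/p)\<close>, normalised by the bounds \<open>A\<close> and \<open>B\<close>, is
  integrated. Positivity of \<open>A\<close> and \<open>B\<close> permits the normalisation, and
  nonnegative integrals avoid any prior integrability of \<open>g\<close>.\<close>

lemma weighted_Holder_pos:
  fixes w g :: "real^'n \<Rightarrow> real"
  assumes p: "1 < p" and g [measurable]: "g \<in> borel_measurable lebesgue" and g0: "\<And>x. 0 \<le> g x"
    and w [measurable]: "w \<in> borel_measurable lebesgue" and wpos: "AE x in lebesgue. 0 < w x"
    and F [measurable]: "F \<in> sets lebesgue"
    and A: "(\<integral>\<^sup>+x. indicator F x * ennreal (g x powr p * w x) \<partial>lebesgue) \<le> ennreal A" "0 < A"
    and B: "wmeas (dual_weight p w) F \<le> ennreal B" "0 < B"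
  shows "(\<integral>\<^sup>+x. indicator F x * ennreal (g x) \<partial>lebesgue) \<le> ennreal (A powr (1/p) * B powr (1 - 1/p))"
proof -
  define q where "q = p / (p - 1)"
  have q: "1 < q" "1/p + 1/q = 1" "1/q = 1 - 1/p" using p by (auto simp: q_def field_simps)
  define c where "c = A powr (1/p) * B powr (1/q)"
  have c: "0 < c" using A B by (simp add: c_def)
  \<comment> \<open>The coefficients are such that the two terms on the right integrate over
    \<open>F\<close> to at most \<open>c / p\<close> and \<open>c / q\<close>.\<close>
  have pt: "g x \<le> c / (A * p) * (g x powr p * w x) + c / (B * q) * dual_weight p w x" if "0 < w x" for x
  proof -
    define a where "a = g x * w x powr (1/p) / A powr (1/p)"
    define b where "b = w x powr (- 1/p) / B powr (1/q)"
    have "a * b = g x / c"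
      using that by (simp add: a_def b_def c_def powr_minus field_simps)
    moreover have "a powr p = g x powr p * w x / A"
      using that g0[of x] p A by (simp add: a_def powr_divide powr_mult powr_powr)
    moreover have "b powr q = dual_weight p w x / B"
    proof -
      \<comment> \<open>The dual weight is the power \<open>- q / p\<close> of
        \<open>w\<close>.\<close>
      have "- q / p = 1 - p/(p-1)" using p by (simp add: q_def field_simps)
      then show ?thesis
        using that q p B by (simp add: b_def powr_divide powr_powr dual_weight_def q_def)
    qed
    moreover have "a * b \<le> a powr p / p + b powr q / q"
      using g0[of x] by (intro Youngs_inequality p q) (auto simp: a_def b_def)
    ultimately have "g x \<le> c * (g x powr p * w x / A / p + dual_weight p w x / B / q)"
      using c by (simp add: divide_le_eq mult.commute)
    then show ?thesis by (simp add: algebra_simps)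
  qed
  have [measurable]: "dual_weight p w \<in> borel_measurable lebesgue"
    unfolding dual_weight_def[abs_def] by measurable
  have "(\<integral>\<^sup>+x. indicator F x * ennreal (g x) \<partial>lebesgue)
    \<le> (\<integral>\<^sup>+x. ennreal (c / (A * p)) * (indicator F x * ennreal (g x powr p * w x)) +
         ennreal (c / (B * q)) * (indicator F x * ennreal (dual_weight p w x)) \<partial>lebesgue)"
    using wpos
  proof (intro nn_integral_mono_AE, elim eventually_mono)
    fix x assume "0 < w x"
    then show "indicator F x * ennreal (g x) \<le> ennreal (c / (A * p)) * (indicator F x * ennreal (g x powr p * w x)) +
         ennreal (c / (B * q)) * (indicator F x * ennreal (dual_weight p w x))"
      using pt[of x] A B p q c
      by (auto simp: indicator_def dual_weight_def simp flip: ennreal_mult ennreal_plus intro!: ennreal_leI)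
  qed
  also have "\<dots> = ennreal (c / (A * p)) * (\<integral>\<^sup>+x. indicator F x * ennreal (g x powr p * w x) \<partial>lebesgue) +
     ennreal (c / (B * q)) * wmeas (dual_weight p w) F"
    unfolding wmeas_def by (subst nn_integral_add) (auto simp: nn_integral_cmult)
  also have "\<dots> \<le> ennreal (c / (A * p)) * ennreal A + ennreal (c / (B * q)) * ennreal B"
    by (intro add_mono mult_left_mono A B) auto
  also have "\<dots> = ennreal (c / (A * p) * A + c / (B * q) * B)"
    using A B c p q by (simp flip: ennreal_mult ennreal_plus)
  also have "c / (A * p) * A + c / (B * q) * B = c * (1/p + 1/q)"
    using A B by (simp add: field_simps)
  finally show ?thesis using q by (simp add: c_def)
qed

section \<open>Consequences of the A_p condition on a single cube\<close>

lemma Ap_char_le: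
  assumes "Ap_weight p w" "is_cube R"
  shows "Ap_char p w R \<le> Ap_const p w"
  unfolding Ap_const_def using assms by (intro cSUP_upper) (auto simp: Ap_weight_def)

lemma measure_is_cube: "is_cube (R :: (real^'n) set) \<Longrightarrow> measure lebesgue R = side R ^ CARD('n)"
  using measure_cube center_side by (metis less_imp_le)

lemma measure_is_cube_pos: "is_cube (R :: (real^'n) set) \<Longrightarrow> 0 < measure lebesgue R"
  using measure_is_cube center_side by (metis zero_less_power)

lemma is_cube_lmeasurable: "is_cube (R :: (real^'n) set) \<Longrightarrow> R \<in> lmeasurable"
  using lmeasurable_cube center_side by (metis less_imp_le)

lemma wmeas_pos:
  fixes w :: "real^'n \<Rightarrow> real"
  assumes [measurable]: "w \<in> borel_measurable lebesgue" and wpos: "AE x in lebesgue. 0 < w x" and "is_cube R"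
  shows "0 < wmeas w R"
proof (rule ccontr)
  have R [measurable]: "R \<in> sets lebesgue" using is_cube_lmeasurable[OF assms(3)] by auto
  assume "\<not> 0 < wmeas w R"
  then have "AE x in lebesgue. indicator R x * ennreal (w x) = 0"
    unfolding wmeas_def by (subst (asm) not_gr_zero) (subst (asm) nn_integral_0_iff_AE, auto)
  with wpos have "AE x in lebesgue. x \<notin> R"
    by eventually_elim (auto simp: indicator_def ennreal_eq_0_iff split: if_splits)
  then have "emeasure lebesgue R = 0" using R
    by (metis (no_types, lifting) AE_iff_measurable Collect_cong Collect_mem_eq UNIV_I not_not space_completion space_lborel space_borel)
  then show False using measure_is_cube_pos[OF assms(3)] by (simp add: measure_def)
qed

text \<open>Hoelder's inequality on \<open>F\<close> produces the power \<open>p - 1\<close> of the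
  dual mass of \<open>F\<close>. This is at most the same power for \<open>R\<close>, which the A_p
  condition trades for |R|^p / w(R). Denominators are cleared throughout.\<close>

lemma Ap_Holder:
  fixes w g :: "real^'n \<Rightarrow> real"
  assumes p: "1 < p" and Ap: "Ap_weight p w" and R: "is_cube R"
    and g [measurable]: "g \<in> borel_measurable lebesgue" and g0: "\<And>x. 0 \<le> g x"
    and F: "F \<in> sets lebesgue" "F \<subseteq> R"
    and N: "(\<integral>\<^sup>+x. indicator F x * ennreal (g x powr p * w x) \<partial>lebesgue) \<le> ennreal N" "0 \<le> N"
  shows "(\<integral>\<^sup>+x. indicator F x * ennreal (g x) \<partial>lebesgue) < \<infinity>" (is "?I < _")
    and "enn2real (\<integral>\<^sup>+x. indicator F x * ennreal (g x) \<partial>lebesgue) powr p * enn2real (wmeas w R)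
      \<le> Ap_const p w * measure lebesgue R powr p * N"
proof -
  have w: "w \<in> borel_measurable lebesgue" "AE x in lebesgue. 0 < w x"
    and fin: "wmeas w R < \<infinity>" "wmeas (dual_weight p w) R < \<infinity>" using Ap R by (auto simp: Ap_weight_def)
  have dm: "dual_weight p w \<in> borel_measurable lebesgue" "AE x in lebesgue. 0 < dual_weight p w x"
    using w by (auto simp: dual_weight_def[abs_def])
  define W where "W = enn2real (wmeas w R)"
  define B where "B = enn2real (wmeas (dual_weight p w) R)"
  define V where "V = measure lebesgue R"
  have B: "0 < B" using wmeas_pos[OF dm R] fin by (simp add: B_def enn2real_positive_iff)
  have V: "0 < V" using measure_is_cube_pos[OF R] by (simp add: V_def)
  have W: "0 \<le> W" by (simp add: W_def)
  have "wmeas (dual_weight p w) F \<le> wmeas (dual_weight p w) R"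
    unfolding wmeas_def using F by (intro nn_integral_mono mult_right_mono) (auto simp: indicator_def)
  also have "\<dots> = ennreal B" using fin by (simp add: B_def)
  finally have FB: "wmeas (dual_weight p w) F \<le> ennreal B" .
  \<comment> \<open>\<open>N\<close> may be zero while \<open>weighted_Holder_pos\<close> needs a
    positive bound, so every \<open>N'\<close> above \<open>N\<close> is used instead.\<close>
  have le: "?I \<le> ennreal (N' powr (1/p) * B powr (1 - 1/p))" if "N < N'" for N'
    using that N order_trans[OF N(1), of "ennreal N'"]
    by (intro weighted_Holder_pos[OF p g g0 w F(1) _ _ FB B]) (auto simp: ennreal_leI)
  show "?I < \<infinity>" using le[of "N+1"] by (auto simp: le_less_trans)
  \<comment> \<open>The A_p condition with denominators cleared: the exponents 1 and
    \<open>p - 1\<close> of |R| add up to \<open>p\<close>.\<close>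
  have char: "W * B powr (p - 1) \<le> Ap_const p w * V powr p"
  proof -
    have "W / V * (B / V) powr (p - 1) \<le> Ap_const p w"
      using Ap_char_le[OF Ap R] by (simp add: Ap_char_def W_def B_def V_def)
    moreover have "W / V * (B / V) powr (p - 1) = W * B powr (p - 1) / V powr p"
    proof -
      have "V powr p = V * V powr (p - 1)" using V by (simp add: powr_diff)
      then show ?thesis using V B by (simp add: powr_divide)
    qed
    ultimately have "W * B powr (p - 1) / V powr p \<le> Ap_const p w" by simp
    then show ?thesis using V by (simp add: divide_le_eq)
  qed
  define Y where "Y = Ap_const p w * V powr p"
  have Y0: "0 \<le> Y" unfolding Y_def using char W by (meson mult_nonneg_nonneg order_trans powr_ge_zero)
  have "enn2real ?I powr p * W \<le> Y * N'" if N': "N < N'" for N'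
  proof -
    have "enn2real ?I \<le> N' powr (1/p) * B powr (1 - 1/p)"
      using le[OF N'] by (intro enn2real_leI) auto
    then have "enn2real ?I powr p \<le> (N' powr (1/p) * B powr (1 - 1/p)) powr p"
      using p by (intro powr_mono2) auto
    also have "\<dots> = N' * B powr (p - 1)"
      using p N' N(2) B by (simp add: powr_mult powr_powr algebra_simps)
    finally have "enn2real ?I powr p * W \<le> N' * B powr (p - 1) * W"
      using W by (rule mult_right_mono)
    also have "\<dots> \<le> N' * Y"
      using char N' N(2) by (simp add: Y_def mult.commute mult.left_commute mult_left_mono)
    finally show ?thesis by (simp add: mult.commute)
  qed
  note * = this
  \<comment> \<open>Let \<open>N'\<close> decrease to \<open>N\<close>. The increment
    \<open>e / (Y + 1)\<close> costs at most \<open>e\<close> and makes sense also when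
    \<open>Y = 0\<close>.\<close>
  have "enn2real ?I powr p * W \<le> Y * N"
  proof (rule field_le_epsilon)
    fix e :: real assume e: "0 < e"
    have "enn2real ?I powr p * W \<le> Y * (N + e / (Y + 1))"
      using Y0 e by (intro *) auto
    also have "\<dots> \<le> Y * N + e" using Y0 e by (simp add: field_simps)
    finally show "enn2real ?I powr p * W \<le> Y * N + e" .
  qed
  then show "enn2real ?I powr p * enn2real (wmeas w R) \<le> Ap_const p w * measure lebesgue R powr p * N"
    by (simp add: W_def Y_def V_def)
qed

text \<open>This is \<open>Ap_Holder\<close> for the constant function 1. A subset with a fixed
  share of |R| thus carries a share of w(R), at the price of one factor of the A_p constant.\<close>

lemma Ap_measure:
  fixes w :: "real^'n \<Rightarrow> real"
  assumes p: "1 < p" and Ap: "Ap_weight p w" and R: "is_cube R" and E: "E \<in> sets lebesgue" "E \<subseteq> R"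
  shows "measure lebesgue E powr p * enn2real (wmeas w R)
    \<le> Ap_const p w * measure lebesgue R powr p * enn2real (wmeas w E)"
proof -
  have "wmeas w E \<le> wmeas w R"
    unfolding wmeas_def using E by (intro nn_integral_mono mult_right_mono) (auto simp: indicator_def)
  moreover have "wmeas w R < \<infinity>" using Ap R by (auto simp: Ap_weight_def)
  ultimately have "wmeas w E = ennreal (enn2real (wmeas w E))"
    by (metis ennreal_enn2real infinity_ennreal_def leD top.not_eq_extremum)
  then have "(\<integral>\<^sup>+x. indicator E x * ennreal (1 powr p * w x) \<partial>lebesgue) \<le> ennreal (enn2real (wmeas w E))"
    by (simp add: wmeas_def)
  from Ap_Holder(2)[OF p Ap R _ _ E this] E show ?thesis
    by (simp add: measure_def)
qed

text \<open>Take \<open>E = R\<close> in \<open>Ap_measure\<close> and cancel. This keeps the later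
  logarithm nonnegative.\<close>

lemma Ap_const_ge_1:
  fixes w :: "real^'n \<Rightarrow> real"
  assumes p: "1 < p" and Ap: "Ap_weight p w"
  shows "1 \<le> Ap_const p w"
proof -
  define R :: "(real^'n) set" where "R = cube 0 1"
  have R: "is_cube R" unfolding is_cube_def R_def using zero_less_one by blast
  have "0 < wmeas w R" "wmeas w R < \<infinity>" using wmeas_pos R Ap by (auto simp: Ap_weight_def)
  then have "0 < enn2real (wmeas w R)" by (simp add: enn2real_positive_iff)
  moreover have "0 < measure lebesgue R powr p" using measure_is_cube_pos[OF R] by simp
  ultimately show ?thesis
    using Ap_measure[OF p Ap R, of R] is_cube_lmeasurable[OF R] by auto
qed

section \<open>Packing for sparse families\<close>

lemma dyadic_cube_sets: "dyadic_cube Q \<Longrightarrow> Q \<in> sets lebesgue"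
  using is_cube_lmeasurable[OF is_cube_dyadic] by auto

lemma countable_sparse: "sparse S \<Longrightarrow> countable S"
  using countable_dyadic_cubes countable_subset[of S "{Q. dyadic_cube Q}"] by (auto simp: sparse_def)

lemma sparse_descendants_sets:
  assumes "sparse S" shows "\<Union>{Q'\<in>S. Q' \<subset> Q} \<in> sets lebesgue"
  using assms countable_subset[OF _ countable_sparse[OF assms], of "{Q'\<in>S. Q' \<subset> Q}"]
  by (intro sets.countable_Union) (auto simp: sparse_def dyadic_cube_sets)

text \<open>\<open>measure\<close> is real-valued, so its monotonicity requires the larger union of
  descendants to have finite measure; that union lies inside \<open>Q\<close>.\<close>

lemma sparse_subset:
  assumes S: "sparse S" and F: "F \<subseteq> S"
  shows "sparse F"
proof -
  have "measure lebesgue (\<Union>{Q'\<in>F. Q' \<subset> Q}) < measure lebesgue Q / 2" if Q: "Q \<in> F" for Q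
  proof -
    have "countable {Q'\<in>F. Q' \<subset> Q}" using F by (intro countable_subset[OF _ countable_sparse[OF S]]) auto
    then have dF: "\<Union>{Q'\<in>F. Q' \<subset> Q} \<in> sets lebesgue"
      using S F by (intro sets.countable_Union) (auto simp: sparse_def dyadic_cube_sets)
    have "Q \<in> lmeasurable" using S F Q by (intro is_cube_lmeasurable is_cube_dyadic) (auto simp: sparse_def)
    then have "\<Union>{Q'\<in>S. Q' \<subset> Q} \<in> lmeasurable"
      by (rule fmeasurableI2) (use sparse_descendants_sets[OF S] in auto)
    then have "measure lebesgue (\<Union>{Q'\<in>F. Q' \<subset> Q}) \<le> measure lebesgue (\<Union>{Q'\<in>S. Q' \<subset> Q})"
      using dF F by (intro measure_mono_fmeasurable) auto
    also have "\<dots> < measure lebesgue Q / 2" using S F Q by (auto simp: sparse_def)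
    finally show ?thesis .
  qed
  then show ?thesis using S F by (auto simp: sparse_def)
qed

text \<open>The usual major subset of a cube in a sparse family. Replacing cubes by these disjoint
  sets makes sums over the family additive.\<close>

definition core :: "(real^'n) set set \<Rightarrow> (real^'n) set \<Rightarrow> (real^'n) set" where
  "core S Q = Q - \<Union>{Q'\<in>S. Q' \<subset> Q}"

lemma core_subset: "core S Q \<subseteq> Q"
  by (auto simp: core_def)

lemma core_sets: "sparse S \<Longrightarrow> Q \<in> S \<Longrightarrow> core S Q \<in> sets lebesgue"
  unfolding core_def by (intro sets.Diff sparse_descendants_sets dyadic_cube_sets) (auto simp: sparse_def)

lemma measure_core:
  assumes S: "sparse S" and Q: "Q \<in> S"
  shows "measure lebesgue Q \<le> 2 * measure lebesgue (core S Q)"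
proof -
  have Qm: "Q \<in> lmeasurable" using S Q by (intro is_cube_lmeasurable is_cube_dyadic) (auto simp: sparse_def)
  have "measure lebesgue (core S Q) = measure lebesgue Q - measure lebesgue (\<Union>{Q'\<in>S. Q' \<subset> Q})"
    unfolding core_def using Qm sparse_descendants_sets[OF S, of Q]
    by (intro measure_Diff) (auto simp: fmeasurable_def)
  moreover have "measure lebesgue (\<Union>{Q'\<in>S. Q' \<subset> Q}) < measure lebesgue Q / 2" using S Q by (auto simp: sparse_def)
  ultimately show ?thesis by simp
qed

text \<open>By nesting, a common point would lie in a proper subcube of the larger cube, and so
  would have been removed from its core.\<close>

lemma disjoint_core:
  assumes S: "sparse S"
  shows "disjoint_family_on (core S) S"
proof (unfold disjoint_family_on_def, intro ballI impI)
  fix Q Q' assume Q: "Q \<in> S" "Q' \<in> S" "Q \<noteq> Q'"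
  show "core S Q \<inter> core S Q' = {}"
  proof (rule ccontr)
    assume "core S Q \<inter> core S Q' \<noteq> {}"
    then obtain x where x: "x \<in> core S Q" "x \<in> core S Q'" by blast
    then have "Q \<subseteq> Q' \<or> Q' \<subseteq> Q"
      using S Q by (intro dyadic_cube_nested[of Q Q' x]) (auto simp: sparse_def core_def)
    then show False using x Q by (auto simp: core_def)
  qed
qed

text \<open>The measure is left general so that both Lebesgue measure and the weighted measure are
  covered.\<close>

lemma sum_core_le:
  assumes S: "sparse F" "finite F" "\<And>Q. Q \<in> F \<Longrightarrow> Q \<subseteq> P"
    and M: "sets M = sets lebesgue" "P \<in> fmeasurable M"
  shows "(\<Sum>Q\<in>F. measure M (core F Q)) \<le> measure M P"
proof -
  have c: "core F Q \<in> fmeasurable M" if "Q \<in> F" for Q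
    using core_sets[OF S(1) that] core_subset[of F Q] S(3)[OF that] M
    by (intro fmeasurableI2[OF M(2)]) auto
  have "(\<Sum>Q\<in>F. measure M (core F Q)) = measure M (\<Union>Q\<in>F. core F Q)"
    using c S(2) disjoint_core[OF S(1)]
    by (intro measure_finite_Union[symmetric]) (force simp: fmeasurable_def)+
  also have "\<dots> \<le> measure M P"
  proof (rule measure_mono_fmeasurable)
    show "(\<Union>Q\<in>F. core F Q) \<subseteq> P" using S(3) core_subset[of F] by blast
    show "(\<Union>Q\<in>F. core F Q) \<in> sets M" by (intro sets.finite_UN S(2) fmeasurableD c)
  qed (rule M(2))
  finally show ?thesis .
qed

text \<open>Each cube has at most twice the measure of its core, and the cores are disjoint subsets
  of \<open>P\<close>.\<close>

lemma sparse_packing: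
  assumes S: "sparse F" "finite F" "\<And>Q. Q \<in> F \<Longrightarrow> Q \<subseteq> P" "P \<in> lmeasurable"
  shows "(\<Sum>Q\<in>F. measure lebesgue Q) \<le> 2 * measure lebesgue P"
proof -
  have "(\<Sum>Q\<in>F. measure lebesgue Q) \<le> (\<Sum>Q\<in>F. 2 * measure lebesgue (core F Q))"
    by (intro sum_mono measure_core S)
  also have "\<dots> \<le> 2 * measure lebesgue P" using sum_core_le[OF S(1-3) refl S(4)] by (simp flip: sum_distrib_left)
  finally show ?thesis .
qed

section \<open>Weighted measures and the Carleson estimate\<close>

definition wmeasure :: "(real^'n \<Rightarrow> real) \<Rightarrow> (real^'n) measure" where
  "wmeasure w = density lebesgue (\<lambda>x. ennreal (w x))"

lemma sets_wmeasure [simp, measurable_cong]: "sets (wmeasure w) = sets lebesgue"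
  by (simp add: wmeasure_def)

lemma space_wmeasure [simp]: "space (wmeasure w) = UNIV"
  by (simp add: wmeasure_def)

lemma emeasure_wmeasure:
  "w \<in> borel_measurable lebesgue \<Longrightarrow> E \<in> sets lebesgue \<Longrightarrow> emeasure (wmeasure w) E = wmeas w E"
  by (simp add: wmeasure_def wmeas_def emeasure_density mult.commute)

lemma measure_wmeasure:
  "w \<in> borel_measurable lebesgue \<Longrightarrow> E \<in> sets lebesgue \<Longrightarrow> measure (wmeasure w) E = enn2real (wmeas w E)"
  by (simp add: measure_def emeasure_wmeasure)

lemma cube_fmeasurable_wmeasure:
  assumes "Ap_weight p w" "is_cube Q"
  shows "Q \<in> fmeasurable (wmeasure w)"
  using assms is_cube_lmeasurable[OF assms(2)]
  by (intro fmeasurableI) (auto simp: emeasure_wmeasure Ap_weight_def)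

text \<open>A core has at least half the volume of its cube, so \<open>Ap_measure\<close> bounds
  w(Q) by \<open>2 powr p * Ap_const p w\<close> times the weight of the core. The cores are
  disjoint inside \<open>P\<close>.\<close>

lemma weighted_packing:
  fixes w :: "real^'n \<Rightarrow> real"
  assumes p: "1 < p" and Ap: "Ap_weight p w"
    and S: "sparse F" "finite F" "\<And>Q. Q \<in> F \<Longrightarrow> Q \<subseteq> P" and P: "is_cube P"
  shows "(\<Sum>Q\<in>F. measure (wmeasure w) Q) \<le> 2 powr p * Ap_const p w * measure (wmeasure w) P"
proof -
  have w: "w \<in> borel_measurable lebesgue" using Ap by (simp add: Ap_weight_def)
  have A: "1 \<le> Ap_const p w" by (rule Ap_const_ge_1[OF p Ap])
  have "measure (wmeasure w) Q \<le> 2 powr p * Ap_const p w * measure (wmeasure w) (core F Q)" if Q: "Q \<in> F" for Q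
  proof -
    have c: "is_cube Q" using S(1) Q is_cube_dyadic by (auto simp: sparse_def)
    let ?V = "measure lebesgue Q" and ?E = "measure lebesgue (core F Q)" and ?W = "measure (wmeasure w) Q"
    have V: "0 < ?V" by (rule measure_is_cube_pos[OF c])
    have "?V powr p \<le> (2 * ?E) powr p"
      using measure_core[OF S(1) Q] V p by (intro powr_mono2) auto
    then have "?V powr p * ?W \<le> 2 powr p * (?E powr p * ?W)"
      by (simp add: powr_mult mult.assoc[symmetric] mult_right_mono)
    also have "\<dots> \<le> 2 powr p * (Ap_const p w * ?V powr p * measure (wmeasure w) (core F Q))"
      using Ap_measure[OF p Ap c core_sets[OF S(1) Q] core_subset] c is_cube_lmeasurable[OF c] core_sets[OF S(1) Q]
      by (simp add: measure_wmeasure w fmeasurableD)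
    also have "\<dots> = ?V powr p * (2 powr p * Ap_const p w * measure (wmeasure w) (core F Q))" by simp
    finally show ?thesis using V by (simp add: mult_le_cancel_left_pos)
  qed
  then have "(\<Sum>Q\<in>F. measure (wmeasure w) Q) \<le> (\<Sum>Q\<in>F. 2 powr p * Ap_const p w * measure (wmeasure w) (core F Q))"
    by (rule sum_mono)
  also have "\<dots> = 2 powr p * Ap_const p w * (\<Sum>Q\<in>F. measure (wmeasure w) (core F Q))"
    by (simp flip: sum_distrib_left)
  also have "\<dots> \<le> 2 powr p * Ap_const p w * measure (wmeasure w) P"
    using A by (intro mult_left_mono sum_core_le[OF S] cube_fmeasurable_wmeasure[OF Ap P]) auto
  finally show ?thesis .
qed

text \<open>Expanding the square gives the weights of all intersections. Nesting leaves pairs with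
  one cube inside the other, symmetry costs a factor 2, and \<open>weighted_packing\<close> sums
  over the inner cubes.\<close>

lemma weighted_square_packing:
  fixes w :: "real^'n \<Rightarrow> real"
  assumes p: "1 < p" and Ap: "Ap_weight p w" and S: "sparse F" "finite F"
  shows "(\<integral>x. (\<Sum>Q\<in>F. indicator Q x)\<^sup>2 \<partial>wmeasure w)
    \<le> 2 * 2 powr p * Ap_const p w * (\<Sum>Q\<in>F. measure (wmeasure w) Q)"
proof -
  let ?m = "measure (wmeasure w)"
  have fm: "Q \<in> fmeasurable (wmeasure w)" if "Q \<in> F" for Q
    using S(1) that is_cube_dyadic by (intro cube_fmeasurable_wmeasure[OF Ap]) (auto simp: sparse_def)
  have fi: "Q \<inter> Q' \<in> fmeasurable (wmeasure w)" if "Q \<in> F" "Q' \<in> F" for Q Q'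
    using fm that by (intro fmeasurable.Int) auto
  have "(\<integral>x. (\<Sum>Q\<in>F. indicator Q x)\<^sup>2 \<partial>wmeasure w) = (\<integral>x. (\<Sum>Q\<in>F. \<Sum>Q'\<in>F. indicat_real (Q \<inter> Q') x) \<partial>wmeasure w)"
    by (simp add: power2_eq_square sum_product indicator_inter_arith)
  also have "\<dots> = (\<Sum>Q\<in>F. \<Sum>Q'\<in>F. ?m (Q \<inter> Q'))"
  proof -
    have int: "integrable (wmeasure w) (indicat_real (Q \<inter> Q'))" if "Q \<in> F" "Q' \<in> F" for Q Q'
      using fi[OF that] by (simp add: fmeasurable_def integrable_indicator_iff)
    show ?thesis by (simp add: Bochner_Integration.integral_sum int Bochner_Integration.integrable_sum)
  qed
  \<comment> \<open>Of two intersecting dyadic cubes one contains the other. The diagonal is counted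
    twice, which only enlarges the bound.\<close>
  also have "\<dots> \<le> (\<Sum>Q\<in>F. \<Sum>Q'\<in>F. (if Q' \<subseteq> Q then ?m Q' else 0) + (if Q \<subseteq> Q' then ?m Q else 0))"
  proof (intro sum_mono)
    fix Q Q' assume Q: "Q \<in> F" "Q' \<in> F"
    show "?m (Q \<inter> Q') \<le> (if Q' \<subseteq> Q then ?m Q' else 0) + (if Q \<subseteq> Q' then ?m Q else 0)"
    proof (cases "Q \<inter> Q' = {}")
      case False
      then have "Q \<subseteq> Q' \<or> Q' \<subseteq> Q" using S(1) Q dyadic_cube_nested[of Q Q'] by (auto simp: sparse_def)
      then show ?thesis by (auto simp: Int_absorb1 Int_absorb2)
    qed auto
  qed
  also have "\<dots> = 2 * (\<Sum>Q\<in>F. \<Sum>Q'\<in>F. if Q' \<subseteq> Q then ?m Q' else 0)"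
  proof -
    have "(\<Sum>Q\<in>F. \<Sum>Q'\<in>F. if Q \<subseteq> Q' then ?m Q else 0) = (\<Sum>Q\<in>F. \<Sum>Q'\<in>F. if Q' \<subseteq> Q then ?m Q' else 0)"
      by (rule sum.swap)
    then show ?thesis by (simp add: sum.distrib)
  qed
  also have "\<dots> = 2 * (\<Sum>Q\<in>F. \<Sum>Q'\<in>{Q'\<in>F. Q' \<subseteq> Q}. ?m Q')"
    using S(2) by (simp add: sum.inter_filter)
  also have "\<dots> \<le> 2 * (\<Sum>Q\<in>F. 2 powr p * Ap_const p w * ?m Q)"
  proof (intro mult_left_mono sum_mono)
    fix Q assume Q: "Q \<in> F"
    show "(\<Sum>Q'\<in>{Q'\<in>F. Q' \<subseteq> Q}. ?m Q') \<le> 2 powr p * Ap_const p w * ?m Q"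
    proof (rule weighted_packing[OF p Ap])
      show "sparse {Q'\<in>F. Q' \<subseteq> Q}" by (rule sparse_subset[OF S(1)]) auto
      show "is_cube Q" using S(1) Q is_cube_dyadic by (auto simp: sparse_def)
    qed (use S(2) in auto)
  qed auto
  finally show ?thesis by (simp add: sum_distrib_left mult.assoc)
qed

section \<open>Selection with bounded overlap\<close>

text \<open>At the largest index whose \<open>F i\<close> contains \<open>x\<close>, fewer than
  \<open>K\<close> earlier sets \<open>R j\<close> contain \<open>x\<close>, hence fewer than
  \<open>K\<close> earlier sets \<open>F j\<close>.\<close>

lemma card_bounded_selection:
  fixes R :: "nat \<Rightarrow> 'a set"
  assumes "\<And>i. F i \<subseteq> {x \<in> R i. card {j. j < i \<and> x \<in> R j} < K}"
  shows "card {i. i < n \<and> x \<in> F i} \<le> K"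
proof (induction n)
  case (Suc n)
  show ?case
  proof (cases "x \<in> F n")
    case True
    then have "card {j. j < n \<and> x \<in> R j} < K" using assms by blast
    moreover have "card {i. i < n \<and> x \<in> F i} \<le> card {j. j < n \<and> x \<in> R j}"
      using assms by (intro card_mono) auto
    moreover have "{i. i < Suc n \<and> x \<in> F i} = insert n {i. i < n \<and> x \<in> F i}"
      using True by (auto simp: less_Suc_eq)
    ultimately show ?thesis by simp
  next
    case False
    then have "{i. i < Suc n \<and> x \<in> F i} = {i. i < n \<and> x \<in> F i}"
      by (auto simp: less_Suc_eq)
    then show ?thesis using Suc by simp
  qed
qed auto

lemma card_eq_sum_indicator:
  "real (card {j. j < (i::nat) \<and> x \<in> R j}) = (\<Sum>j<i. indicat_real (R j) x)"
proof -
  have "(\<Sum>j<i. indicat_real (R j) x) = real (card ({..<i} \<inter> {j. x \<in> R j}))"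
    by (simp add: indicator_def sum.If_cases)
  moreover have "{..<i} \<inter> {j. x \<in> R j} = {j. j < i \<and> x \<in> R j}" by auto
  ultimately show ?thesis by simp
qed

text \<open>Where at least \<open>K\<close> of the earlier sets meet \<open>R i\<close>, Markov's inequality for the counting
  function makes the measure small; elsewhere the overlap is at most \<open>K\<close> by construction.\<close>
lemma bounded_overlap_selection:
  fixes R :: "nat \<Rightarrow> 'a set" and K n :: nat
  assumes K: "0 < K" and R: "\<And>i. i < n \<Longrightarrow> R i \<in> fmeasurable M"
    and le: "\<And>i. i < n \<Longrightarrow> (\<Sum>j<i. measure M (R i \<inter> R j)) \<le> K / 2 * measure M (R i)"
  obtains F where "\<And>i. i < n \<Longrightarrow> F i \<in> sets M" "\<And>i. F i \<subseteq> R i"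
    "\<And>i. i < n \<Longrightarrow> measure M (R i) \<le> 2 * measure M (F i)"
    "\<And>x. card {i. i < n \<and> x \<in> F i} \<le> K"
proof -
  define F where "F i = {x \<in> R i. card {j. j < i \<and> x \<in> R j} < K}" for i
  have FR: "F i \<subseteq> R i" for i by (auto simp: F_def)
  have sub: "F i \<subseteq> {x \<in> R i. card {j. j < i \<and> x \<in> R j} < K}" for i by (simp add: F_def)
  have F: "F i \<in> sets M" if "i < n" for i
  proof -
    have Rj: "R j \<in> sets M" if "j \<le> i" for j using R \<open>i < n\<close> that by auto
    have *: "F i = R i \<inter> {x \<in> space M. (\<Sum>j<i. indicat_real (R j) x) < real K}"
      using sets.sets_into_space[OF fmeasurableD[OF R[OF that]]] by (auto simp: F_def simp flip: card_eq_sum_indicator)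
    have "(\<lambda>x. \<Sum>j<i. indicat_real (R j) x) \<in> borel_measurable M"
      by (intro borel_measurable_sum borel_measurable_indicator) (auto intro: Rj)
    then have "{x \<in> space M. (\<Sum>j<i. indicat_real (R j) x) < real K} \<in> sets M"
      by (intro borel_measurable_less borel_measurable_const)
    then show ?thesis unfolding * using R[OF that] by (intro sets.Int) auto
  qed
  have half: "measure M (R i) \<le> 2 * measure M (F i)" if i: "i < n" for i
  proof -
    have Fi: "F i \<in> fmeasurable M" by (rule fmeasurableI2[OF R[OF i] FR F[OF i]])
    have D: "R i - F i \<in> fmeasurable M" by (rule fmeasurable_Diff[OF R[OF i] fmeasurableD[OF Fi]])
    have I: "R i \<inter> R j \<in> fmeasurable M" if "j < i" for j using R[OF i] R[of j] i that by (intro fmeasurable.Int) auto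
    have int: "integrable M (indicat_real A)" if "A \<in> fmeasurable M" for A
      using that by (auto simp: integrable_indicator_iff fmeasurable_def)
    have mI: "(\<integral>x. indicat_real A x \<partial>M) = measure M A" if "A \<in> fmeasurable M" for A
      using sets.sets_into_space[OF fmeasurableD[OF that]] by (simp add: Int_absorb2)
    have "K * measure M (R i - F i) = (\<integral>x. K * indicat_real (R i - F i) x \<partial>M)"
      using mI[OF D] by simp
    also have "\<dots> \<le> (\<integral>x. (\<Sum>j<i. indicat_real (R i \<inter> R j) x) \<partial>M)"
    proof (rule integral_mono)
      fix x
      show "K * indicat_real (R i - F i) x \<le> (\<Sum>j<i. indicat_real (R i \<inter> R j) x)"
      proof (cases "x \<in> R i - F i")
        case True
        then have "K \<le> card {j. j < i \<and> x \<in> R j}" by (auto simp: F_def)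
        then have "real K \<le> (\<Sum>j<i. indicat_real (R j) x)" by (subst card_eq_sum_indicator[symmetric]) simp
        also have "\<dots> = (\<Sum>j<i. indicat_real (R i \<inter> R j) x)" using True by (simp add: indicator_inter_arith)
        finally show ?thesis using True by simp
      qed (simp add: sum_nonneg)
    qed (use int D I in \<open>auto intro!: Bochner_Integration.integrable_sum integrable_mult_right\<close>)
    also have "\<dots> = (\<Sum>j<i. measure M (R i \<inter> R j))"
      using int mI I by (subst Bochner_Integration.integral_sum) auto
    also have "\<dots> \<le> K / 2 * measure M (R i)" by (rule le[OF i])
    finally have "measure M (R i - F i) \<le> measure M (R i) / 2" using K by simp
    moreover have "measure M (R i - F i) = measure M (R i) - measure M (F i)"
      by (rule measure_Diff) (use R[OF i] Fi FR in \<open>auto simp: fmeasurable_def\<close>)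
    ultimately show ?thesis by simp
  qed
  show thesis
    by (rule that[OF F FR half card_bounded_selection[OF sub]])
qed

text \<open>The left side is the integral of the number of sets containing a point, and this number
  is at most \<open>K\<close>.\<close>

lemma sum_measure_bounded_overlap:
  fixes F :: "nat \<Rightarrow> 'a set"
  assumes fin: "finite_measure M" and F: "\<And>i. i < n \<Longrightarrow> F i \<in> sets M"
    and K: "\<And>x. card {i. i < n \<and> x \<in> F i} \<le> K"
  shows "(\<Sum>i<n. measure M (F i)) \<le> K * measure M (space M)"
proof -
  interpret finite_measure M by fact
  have "(\<Sum>i<n. measure M (F i)) = (\<integral>x. (\<Sum>i<n. indicat_real (F i) x) \<partial>M)"
    using F sets.sets_into_space[OF F]
    by (subst Bochner_Integration.integral_sum) (auto simp: integrable_indicator_iff emeasure_finite less_top[symmetric] Int_absorb2)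
  also have "\<dots> \<le> (\<integral>x. real K \<partial>M)"
  proof (rule integral_mono)
    show "integrable M (\<lambda>x. \<Sum>i<n. indicat_real (F i) x)"
      using F by (auto simp: integrable_indicator_iff emeasure_finite less_top[symmetric] intro!: Bochner_Integration.integrable_sum)
    show "(\<Sum>i<n. indicat_real (F i) x) \<le> real K" for x
      using K[of x] by (simp flip: card_eq_sum_indicator)
  qed simp
  also have "\<dots> = K * measure M (space M)" by simp
  finally show ?thesis .
qed

section \<open>Dilated cubes and the estimate for a single level of averages\<close>

lemma cube_subset_dilate:
  fixes c c' :: "real^'n"
  assumes "cube c r \<inter> cube c' r' \<noteq> {}" "r' \<le> r"
  shows "cube c' r' \<subseteq> cube c (3 * r)"
proof
  obtain x where x: "x \<in> cube c r" "x \<in> cube c' r'" using assms by blast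
  fix y assume y: "y \<in> cube c' r'"
  show "y \<in> cube c (3 * r)"
    unfolding cube_def
  proof (intro CollectI allI)
    fix i
    have "c $ i - r/2 \<le> x$i" "x$i < c$i + r/2" "c'$i - r'/2 \<le> x$i" "x$i < c'$i + r'/2"
      "c'$i - r'/2 \<le> y$i" "y$i < c'$i + r'/2" using x y by (auto simp: cube_def)
    \<comment> \<open>In each coordinate \<open>y\<close> is within \<open>r'\<close> of
      \<open>x\<close>, and \<open>x\<close> is within \<open>r / 2\<close> of \<open>c\<close>;
      this is the source of the factor 3.\<close>
    then show "c $ i - 3 * r / 2 \<le> y $ i \<and> y $ i < c $ i + 3 * r / 2" using assms(2) by linarith
  qed
qed

lemma cube_mono:
  assumes "r \<le> r'" shows "cube c r \<subseteq> cube c r'"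
proof
  fix x assume x: "x \<in> cube c r"
  have "c $ i - r' / 2 \<le> x $ i \<and> x $ i < c $ i + r' / 2" for i
  proof -
    have "c $ i - r / 2 \<le> x $ i" "x $ i < c $ i + r / 2" using x by (auto simp: cube_def)
    then show ?thesis using assms by linarith
  qed
  then show "x \<in> cube c r'" by (simp add: cube_def)
qed

lemma avg_abs_eq_measure:
  fixes f :: "real^'n \<Rightarrow> real"
  assumes f [measurable]: "f \<in> borel_measurable lebesgue" and R [measurable]: "R \<in> sets lebesgue"
  shows "avg (\<lambda>x. \<bar>f x\<bar>) R = measure (wmeasure (\<lambda>x. \<bar>f x\<bar>)) R / measure lebesgue R"
proof -
  have "(LINT y:R|lebesgue. \<bar>f y\<bar>) = enn2real (\<integral>\<^sup>+y. ennreal (indicator R y * \<bar>f y\<bar>) \<partial>lebesgue)"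
    unfolding set_lebesgue_integral_def by (subst integral_eq_nn_integral) auto
  also have "(\<integral>\<^sup>+y. ennreal (indicator R y * \<bar>f y\<bar>) \<partial>lebesgue) = wmeas (\<lambda>x. \<bar>f x\<bar>) R"
    unfolding wmeas_def by (intro nn_integral_cong) (auto simp: indicator_def)
  finally show ?thesis by (simp add: avg_def measure_wmeasure)
qed

text \<open>The 8 is a product of three factors 2: averages vary by 2 within a level,
  \<open>sparse_packing\<close> costs 2, and Markov's inequality is to retain half of the mass. The
  power is the volume ratio of \<open>3 \<rho> Q\<close> to \<open>Q\<close>.\<close>

definition overlap_const :: "'n itself \<Rightarrow> real \<Rightarrow> nat" where
  "overlap_const _ \<rho> = nat \<lceil>8 * (3 * \<rho>) ^ CARD('n)\<rceil>"

text \<open>The selected sets \<open>F i\<close> inside the dilates \<open>R i\<close> satisfy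
  \<open>a / 2 * |R i| \<le> ?\<eta> (F i)\<close>. Then \<open>Ap_Holder\<close> bounds w(Q i) by
  \<open>2 powr p * Ap_const p w * a powr (-p)\<close> times the \<open>?\<mu>\<close> measure of
  \<open>F i\<close>, and bounded overlap sums these measures to at most \<open>K\<close> times the
  total mass of \<open>?\<mu>\<close>.\<close>

lemma level_sum:
  fixes w f :: "real^'n \<Rightarrow> real"
  assumes p: "1 < p" and rho: "1 \<le> \<rho>" and Ap: "Ap_weight p w" and f: "in_Lp_w p w f"
    and G: "sparse G" "finite G" and a: "0 < a"
    and lev: "\<And>Q. Q \<in> G \<Longrightarrow> a < avg (\<lambda>x. \<bar>f x\<bar>) (dilate \<rho> Q)" "\<And>Q. Q \<in> G \<Longrightarrow> avg (\<lambda>x. \<bar>f x\<bar>) (dilate \<rho> Q) \<le> 2 * a"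
  shows "(\<Sum>Q\<in>G. measure (wmeasure w) Q)
    \<le> 2 powr p * overlap_const TYPE('n) \<rho> * Ap_const p w * (Lp_w_norm p w f powr p) * a powr (- p)"
proof -
  let ?\<eta> = "wmeasure (\<lambda>x. \<bar>f x\<bar>)" and ?\<mu> = "wmeasure (\<lambda>x. \<bar>f x\<bar> powr p * w x)" and ?\<nu> = "wmeasure w"
  define K where "K = overlap_const TYPE('n) \<rho>"
  have fm [measurable]: "f \<in> borel_measurable lebesgue" using f by (simp add: in_Lp_w_def)
  have wm [measurable]: "w \<in> borel_measurable lebesgue" using Ap by (simp add: Ap_weight_def)
  have "emeasure ?\<mu> (space ?\<mu>) = (\<integral>\<^sup>+x. ennreal (\<bar>f x\<bar> powr p * w x) \<partial>lebesgue)"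
    by (simp add: emeasure_wmeasure wmeas_def)
  then have muN: "measure ?\<mu> (space ?\<mu>) = Lp_w_norm p w f powr p" and fin: "finite_measure ?\<mu>"
    using f p by (auto simp: measure_def Lp_w_norm_def powr_powr in_Lp_w_def intro!: finite_measureI)
  obtain ys where ys: "set ys = G" "distinct ys" using finite_distinct_list[OF G(2)] by blast
  \<comment> \<open>Sorting by side length makes every earlier dilate no larger than the current
    one, as \<open>cube_subset_dilate\<close> demands.\<close>
  define xs where "xs = sort_key side ys"
  have xs: "set xs = G" "distinct xs" "sorted (map side xs)" using ys by (auto simp: xs_def)
  define n where "n = length xs"
  define Q where "Q i = xs ! i" for i
  define R where "R i = dilate \<rho> (Q i)" for i
  have QG: "Q i \<in> G" if "i < n" for i using that xs unfolding Q_def n_def by auto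
  have sidemono: "side (Q j) \<le> side (Q i)" if "j < i" "i < n" for i j
    using sorted_nth_mono[OF xs(3), of j i] that by (simp add: Q_def n_def)
  have bij: "bij_betw Q {..<n} G"
    unfolding Q_def n_def using xs bij_betw_nth[of xs "{..<length xs}" G] by auto
  have Qc: "is_cube (Q i)" if "i < n" for i
    using QG[OF that] G(1) is_cube_dyadic by (auto simp: sparse_def)
  have R: "R i = cube (center (Q i)) (\<rho> * side (Q i))" if "i < n" for i
    unfolding R_def using dilate_eq[OF Qc[OF that]] .
  have Rc: "is_cube (R i)" if "i < n" for i
    unfolding R[OF that] is_cube_def using center_side(1)[OF Qc[OF that]] rho
    by (intro exI[of _ "center (Q i)"] exI[of _ "\<rho> * side (Q i)"]) auto
  have Rm: "R i \<in> lmeasurable" if "i < n" for i using is_cube_lmeasurable Rc that by blast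
  have VR: "measure lebesgue (R i) = (\<rho> * side (Q i)) ^ CARD('n)" if "i < n" for i
    unfolding R[OF that] using center_side(1)[OF Qc[OF that]] rho by (intro measure_cube) auto
  have VQ: "measure lebesgue (Q i) = side (Q i) ^ CARD('n)" if "i < n" for i
    using measure_is_cube[OF Qc[OF that]] .
  have QR: "Q i \<subseteq> R i" if "i < n" for i
  proof -
    have "cube (center (Q i)) (side (Q i)) \<subseteq> cube (center (Q i)) (\<rho> * side (Q i))"
      using center_side(1)[OF Qc[OF that]] rho by (intro cube_mono) simp
    then show ?thesis unfolding R[OF that] center_side(2)[OF Qc[OF that], symmetric] .
  qed
  have V0: "0 < measure lebesgue (R i)" if "i < n" for i using measure_is_cube_pos[OF Rc[OF that]] .
  have av: "a * measure lebesgue (R i) < measure ?\<eta> (R i)" "measure ?\<eta> (R i) \<le> 2 * a * measure lebesgue (R i)" if "i < n" for i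
    using lev[OF QG[OF that]] V0[OF that] avg_abs_eq_measure[OF fm, of "R i"] Rm[OF that]
    by (auto simp: R_def[symmetric] field_simps fmeasurableD)
  \<comment> \<open>Besides the inequality this yields local integrability of \<open>f\<close>, so
    that \<open>?\<eta>\<close> is finite on every \<open>R i\<close>.\<close>
  have Holder: "F \<in> fmeasurable ?\<eta>"
      "measure ?\<eta> F powr p * measure ?\<nu> (R i) \<le> Ap_const p w * measure lebesgue (R i) powr p * measure ?\<mu> F"
    if "i < n" "F \<in> sets lebesgue" "F \<subseteq> R i" for i F
  proof -
    have "(\<integral>\<^sup>+x. indicator F x * ennreal (\<bar>f x\<bar> powr p * w x) \<partial>lebesgue) = emeasure ?\<mu> F"
      using that by (simp add: emeasure_wmeasure wmeas_def)
    also have "\<dots> = ennreal (measure ?\<mu> F)" using fin by (simp add: finite_measure.emeasure_eq_measure)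
    finally have *: "(\<integral>\<^sup>+x. indicator F x * ennreal (\<bar>f x\<bar> powr p * w x) \<partial>lebesgue) \<le> ennreal (measure ?\<mu> F)" by simp
    note H = Ap_Holder[OF p Ap Rc[OF that(1)], of "\<lambda>x. \<bar>f x\<bar>", OF _ _ that(2,3) *]
    show "F \<in> fmeasurable ?\<eta>"
      using H(1) that by (intro fmeasurableI) (auto simp: emeasure_wmeasure wmeas_def)
    show "measure ?\<eta> F powr p * measure ?\<nu> (R i) \<le> Ap_const p w * measure lebesgue (R i) powr p * measure ?\<mu> F"
      using H(2) that Rm[OF that(1)] by (simp add: measure_wmeasure fmeasurableD wmeas_def)
  qed
  have Reta: "R i \<in> fmeasurable ?\<eta>" if "i < n" for i using Holder(1)[OF that] Rm[OF that] by auto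
  have K8: "8 * (3 * \<rho>) ^ CARD('n) \<le> real K"
    unfolding K_def overlap_const_def by linarith
  have K0: "0 < K"
  proof -
    have "0 < 8 * (3 * \<rho>) ^ CARD('n)" using rho by simp
    then show ?thesis using K8 by linarith
  qed
  have Rsum: "(\<Sum>j<i. measure ?\<eta> (R i \<inter> R j)) \<le> K / 2 * measure ?\<eta> (R i)" if i: "i < n" for i
  proof -
    define J where "J = {j. j < i \<and> R i \<inter> R j \<noteq> {}}"
    \<comment> \<open>The threefold dilate of \<open>R i\<close> contains every earlier cube whose
      dilate meets \<open>R i\<close>.\<close>
    define P where "P = cube (center (Q i)) (3 * (\<rho> * side (Q i)))"
    have s0: "0 < side (Q i)" using center_side(1)[OF Qc[OF i]] .
    have Jn: "j < n" "j < i" if "j \<in> J" for j using that i by (auto simp: J_def)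
    have QP: "Q j \<subseteq> P" if "j \<in> J" for j
    proof -
      have "\<rho> * side (Q j) \<le> \<rho> * side (Q i)" using sidemono[of j i] that i rho by (auto simp: J_def)
      moreover have "cube (center (Q i)) (\<rho> * side (Q i)) \<inter> cube (center (Q j)) (\<rho> * side (Q j)) \<noteq> {}"
        using that R[OF i] R[OF Jn(1)[OF that]] by (simp add: J_def)
      ultimately have "R j \<subseteq> P" unfolding P_def R[OF Jn(1)[OF that]] by (intro cube_subset_dilate)
      then show ?thesis using QR[OF Jn(1)[OF that]] by blast
    qed
    have injJ: "inj_on Q J" using bij Jn by (auto simp: bij_betw_def inj_on_def)
    have "(\<Sum>j<i. measure ?\<eta> (R i \<inter> R j)) = (\<Sum>j\<in>J. measure ?\<eta> (R i \<inter> R j))"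
      by (rule sum.mono_neutral_right) (auto simp: J_def)
    also have "\<dots> \<le> (\<Sum>j\<in>J. measure ?\<eta> (R j))"
      using Jn Reta Rm i by (intro sum_mono measure_mono_fmeasurable) (auto simp: fmeasurableD)
    also have "\<dots> \<le> (\<Sum>j\<in>J. 2 * a * measure lebesgue (R j))"
      using av Jn by (intro sum_mono) auto
    \<comment> \<open>Sparseness concerns the cubes \<open>Q j\<close> and not their dilates, so the
      volumes are first scaled back.\<close>
    also have "\<dots> = 2 * a * \<rho> ^ CARD('n) * (\<Sum>j\<in>J. measure lebesgue (Q j))"
      using VR VQ Jn by (simp add: sum_distrib_left power_mult_distrib mult.assoc)
    also have "(\<Sum>j\<in>J. measure lebesgue (Q j)) = (\<Sum>q\<in>Q ` J. measure lebesgue q)"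
      using injJ by (simp add: sum.reindex)
    also have "2 * a * \<rho> ^ CARD('n) * \<dots> \<le> 2 * a * \<rho> ^ CARD('n) * (2 * measure lebesgue P)"
    proof (intro mult_left_mono sparse_packing)
      show "sparse (Q ` J)" using QG Jn by (intro sparse_subset[OF G(1)]) auto
      show "finite (Q ` J)" unfolding J_def by auto
      show "P \<in> lmeasurable" unfolding P_def using s0 rho by (intro lmeasurable_cube) auto
    qed (use QP a rho in auto)
    also have "measure lebesgue P = 3 ^ CARD('n) * measure lebesgue (R i)"
      unfolding P_def VR[OF i] using s0 rho by (subst measure_cube) (auto simp: power_mult_distrib)
    also have "2 * a * \<rho> ^ CARD('n) * (2 * (3 ^ CARD('n) * measure lebesgue (R i))) =
        4 * (3 * \<rho>) ^ CARD('n) * (a * measure lebesgue (R i))"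
      by (simp add: power_mult_distrib)
    also have "\<dots> \<le> K / 2 * measure ?\<eta> (R i)"
      using K8 av(1)[OF i] a by (intro mult_mono) auto
    finally show ?thesis .
  qed
  obtain F where F: "\<And>i. i < n \<Longrightarrow> F i \<in> sets ?\<eta>" "\<And>i. F i \<subseteq> R i"
    "\<And>i. i < n \<Longrightarrow> measure ?\<eta> (R i) \<le> 2 * measure ?\<eta> (F i)"
    "\<And>x. card {i. i < n \<and> x \<in> F i} \<le> K"
  proof (rule bounded_overlap_selection[OF K0, of n R ?\<eta>])
    fix F assume "\<And>i. i < n \<Longrightarrow> F i \<in> sets ?\<eta>" "\<And>i. F i \<subseteq> R i"
      "\<And>i. i < n \<Longrightarrow> measure ?\<eta> (R i) \<le> 2 * measure ?\<eta> (F i)"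
      "\<And>x. card {i. i < n \<and> x \<in> F i} \<le> K"
    then show thesis by (rule that)
  qed (erule Reta Rsum)+
  have one: "measure ?\<nu> (Q i) \<le> 2 powr p * Ap_const p w * a powr (-p) * measure ?\<mu> (F i)" if i: "i < n" for i
  proof -
    let ?V = "measure lebesgue (R i)"
    have "a / 2 * ?V \<le> measure ?\<eta> (F i)" using av(1)[OF i] F(3)[OF i] by simp
    then have "(a / 2 * ?V) powr p \<le> measure ?\<eta> (F i) powr p"
      using a V0[OF i] p by (intro powr_mono2) auto
    then have "(a / 2 * ?V) powr p * measure ?\<nu> (R i) \<le> measure ?\<eta> (F i) powr p * measure ?\<nu> (R i)"
      by (rule mult_right_mono) simp
    also have "\<dots> \<le> Ap_const p w * ?V powr p * measure ?\<mu> (F i)"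
      using Holder(2)[OF i _ F(2)] F(1)[OF i] by simp
    finally have "?V powr p * ((a / 2) powr p * measure ?\<nu> (R i)) \<le> ?V powr p * (Ap_const p w * measure ?\<mu> (F i))"
      by (subst (asm) powr_mult) (auto simp: mult_ac simp del: times_divide_eq_left times_divide_eq_right)
    then have "(a / 2) powr p * measure ?\<nu> (R i) \<le> Ap_const p w * measure ?\<mu> (F i)"
      using V0[OF i] by (simp add: mult_le_cancel_left_pos)
    then have "measure ?\<nu> (R i) \<le> Ap_const p w * measure ?\<mu> (F i) / (a / 2) powr p"
      using a by (simp add: le_divide_eq mult.commute)
    also have "\<dots> = 2 powr p * Ap_const p w * a powr (-p) * measure ?\<mu> (F i)"
      using a by (simp add: powr_divide powr_minus field_simps)
    finally show ?thesis
      using measure_mono_fmeasurable[OF QR[OF i] _ cube_fmeasurable_wmeasure[OF Ap Rc[OF i]]] is_cube_lmeasurable[OF Qc[OF i]]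
      by (auto simp: fmeasurableD)
  qed
  have A1: "1 \<le> Ap_const p w" by (rule Ap_const_ge_1[OF p Ap])
  have "(\<Sum>Q\<in>G. measure ?\<nu> Q) = (\<Sum>i<n. measure ?\<nu> (Q i))"
    using sum.reindex_bij_betw[OF bij, of "measure ?\<nu>"] by simp
  also have "\<dots> \<le> (\<Sum>i<n. 2 powr p * Ap_const p w * a powr (-p) * measure ?\<mu> (F i))"
    using one by (intro sum_mono) auto
  also have "\<dots> = 2 powr p * Ap_const p w * a powr (-p) * (\<Sum>i<n. measure ?\<mu> (F i))"
    by (simp add: sum_distrib_left)
  also have "\<dots> \<le> 2 powr p * Ap_const p w * a powr (-p) * (K * measure ?\<mu> (space ?\<mu>))"
    using F A1 by (intro mult_left_mono sum_measure_bounded_overlap[OF fin]) auto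
  finally show ?thesis unfolding muN K_def by (simp add: mult_ac)
qed

section \<open>Families with controlled dyadic levels\<close>

lemma Markov_strict:
  assumes u: "integrable M u" and u0: "\<And>x. 0 \<le> u x" and c: "0 < (c::real)"
  shows "{x \<in> space M. c < u x} \<in> fmeasurable M"
    and "measure M {x \<in> space M. c < u x} \<le> (\<integral>x. u x \<partial>M) / c"
proof -
  have [measurable]: "u \<in> borel_measurable M" using u by auto
  have "emeasure M {x \<in> space M. u x \<ge> c} \<le> ennreal ((1/c) * (\<integral>x. u x \<partial>M))"
    using integral_Markov_inequality[OF u, of c] u0 c by auto
  then have fm: "{x \<in> space M. c \<le> u x} \<in> fmeasurable M"
    by (intro fmeasurableI) (auto simp: le_less_trans)
  show "{x \<in> space M. c < u x} \<in> fmeasurable M"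
    by (rule fmeasurableI2[OF fm]) auto
  have "measure M {x \<in> space M. c < u x} \<le> measure M {x \<in> space M. c \<le> u x}"
    by (rule measure_mono_fmeasurable[OF _ _ fm]) auto
  also have "\<dots> \<le> (\<integral>x. u x \<partial>M) / c"
    using integral_Markov_inequality_measure[OF u, of "{}" c] u0 c by auto
  finally show "measure M {x \<in> space M. c < u x} \<le> (\<integral>x. u x \<partial>M) / c" .
qed

lemma geometric_tail_le:
  fixes s :: real
  assumes s: "0 \<le> s" "s < 1"
  shows "(\<Sum>k\<in>{m..<n}. s ^ k) \<le> s ^ m / (1 - s)"
proof (cases "m \<le> n")
  case True
  then have "(\<Sum>k\<in>{m..<n}. s ^ k) = (s ^ m - s ^ n) / (1 - s)"
  proof (induction n rule: dec_induct)
    case (step n)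
    have "(\<Sum>k\<in>{m..<Suc n}. s ^ k) = (s ^ m - s ^ n) / (1 - s) + s ^ n" using step by simp
    moreover have "s ^ n = (s ^ n - s ^ Suc n) / (1 - s)" using s by (simp add: field_simps)
    ultimately show ?case by (simp add: diff_divide_distrib del: sum.op_ivl_Suc)
  qed simp
  also have "\<dots> \<le> s ^ m / (1 - s)" using s by (intro divide_right_mono) auto
  finally show ?thesis .
qed (use s in simp)

lemma four_power: "(4::real) ^ k = 2 powr (2 * real k)"
  by (simp add: powr_realpow powr_powr[symmetric])

text \<open>This separates the summation over levels from the geometry. \<open>\<alpha> Q\<close>
  stands for the average of |f| over the dilate, \<open>B\<close> for a constant times the A_p
  constant times the p-th power of the norm, and \<open>level\<close> for the conclusion of
  \<open>level_sum\<close>.\<close>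

locale level_family =
  fixes M :: "'a measure" and F :: "'a set set" and \<alpha> :: "'a set \<Rightarrow> real" and p B :: real
  assumes finF: "finite F" and FM: "\<And>Q. Q \<in> F \<Longrightarrow> Q \<in> fmeasurable M"
    and \<alpha>0: "\<And>Q. 0 \<le> \<alpha> Q" and p: "1 < p" and B0: "0 \<le> B"
    and level: "\<And>G a. G \<subseteq> F \<Longrightarrow> 0 < a \<Longrightarrow> (\<And>Q. Q \<in> G \<Longrightarrow> a < \<alpha> Q \<and> \<alpha> Q \<le> 2 * a)
      \<Longrightarrow> (\<Sum>Q\<in>G. measure M Q) \<le> B * a powr (- p)"
begin

definition lev :: "nat \<Rightarrow> 'a set set" where
  "lev k = {Q \<in> F. (1/2) ^ Suc k < \<alpha> Q \<and> \<alpha> Q \<le> (1/2) ^ k}"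

definition partial_square :: "nat \<Rightarrow> nat \<Rightarrow> 'a \<Rightarrow> real" where
  "partial_square m n x = (\<Sum>k\<in>{m..<n}. \<Sum>Q\<in>lev k. (\<alpha> Q)\<^sup>2 * indicator Q x)"

lemma finite_lev: "finite (lev k)" and lev_subset: "lev k \<subseteq> F"
  using finF by (auto simp: lev_def)

lemma integrable_indicator: "Q \<in> F \<Longrightarrow> integrable M (indicat_real Q)"
  using FM[of Q] by (simp add: fmeasurable_def integrable_indicator_iff)

lemma sum_lev_le: "(\<Sum>Q\<in>lev k. measure M Q) \<le> B * 2 powr p * (2 powr p) ^ k"
proof -
  \<comment> \<open>The band is an instance of \<open>level\<close> with
    \<open>a = (1/2) ^ Suc k\<close>.\<close>
  have "(\<Sum>Q\<in>lev k. measure M Q) \<le> B * ((1/2) ^ Suc k) powr (- p)"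
    by (rule level) (auto simp: lev_def)
  also have "((1/2::real) ^ Suc k) powr (- p) = 2 powr p * (2 powr p) ^ k"
  proof -
    have "(1/2::real) ^ Suc k = 2 powr (- real (Suc k))"
      by (simp add: powr_minus powr_realpow power_one_over inverse_eq_divide del: of_nat_Suc power_Suc)
    moreover have "2 powr p * (2 powr p) ^ k = 2 powr (real (Suc k) * p)"
      by (simp add: powr_realpow[symmetric] powr_powr powr_add[symmetric] algebra_simps)
    ultimately show ?thesis by (simp add: powr_powr del: of_nat_Suc power_Suc)
  qed
  finally show ?thesis by (simp add: mult.assoc)
qed

text \<open>The levels \<open>a = 2 ^ k\<close> form a convergent geometric series, and finiteness
  of \<open>F\<close> leaves only finitely many of them.\<close>

lemma large_le:
  "(\<Sum>Q\<in>{Q\<in>F. 1 < \<alpha> Q}. measure M Q) \<le> 2 * B"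
proof -
  have ind: "(\<Sum>Q\<in>{Q\<in>F. 1 < \<alpha> Q \<and> \<alpha> Q \<le> 2 ^ n}. measure M Q) \<le> (\<Sum>k\<in>{0..<n}. B * (1/2) ^ k)" for n
  proof (induction n)
    case 0
    have "{Q\<in>F. 1 < \<alpha> Q \<and> \<alpha> Q \<le> 2 ^ 0} = {}" by auto
    then show ?case by (simp only:) simp
  next
    case (Suc n)
    have "(1::real) \<le> 2 ^ n" by simp
    then have "1 < \<alpha> Q \<and> \<alpha> Q \<le> 2 ^ Suc n \<longleftrightarrow> 1 < \<alpha> Q \<and> \<alpha> Q \<le> 2 ^ n \<or> 2 ^ n < \<alpha> Q \<and> \<alpha> Q \<le> 2 ^ Suc n" for Q
      unfolding power_Suc by linarith
    then have eq: "{Q\<in>F. 1 < \<alpha> Q \<and> \<alpha> Q \<le> 2 ^ Suc n} = {Q\<in>F. 1 < \<alpha> Q \<and> \<alpha> Q \<le> 2 ^ n} \<union> {Q\<in>F. 2 ^ n < \<alpha> Q \<and> \<alpha> Q \<le> 2 ^ Suc n}"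
      by blast
    have "(\<Sum>Q\<in>{Q\<in>F. 2 ^ n < \<alpha> Q \<and> \<alpha> Q \<le> 2 ^ Suc n}. measure M Q) \<le> B * (2 ^ n) powr (- p)"
      by (rule level) auto
    \<comment> \<open>Weakening the exponent \<open>p\<close> to 1 gives the ratio 1/2, hence the
      constant 2 for every \<open>p\<close>.\<close>
    also have "\<dots> \<le> B * (2 ^ n) powr (- 1)"
      using p B0 by (intro mult_left_mono powr_mono) auto
    also have "\<dots> = B * (1/2) ^ n" by (simp add: powr_minus power_one_over inverse_eq_divide)
    finally show ?case
      unfolding eq using finF Suc by (subst sum.union_disjoint) auto
  qed
  obtain n where n: "Max (insert 1 (\<alpha> ` F)) < 2 ^ n" using real_arch_pow[of 2] by auto
  have "\<alpha> Q \<le> 2 ^ n" if "Q \<in> F" for Q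
    using Max_ge[of "insert 1 (\<alpha> ` F)" "\<alpha> Q"] that finF n by auto
  then have "{Q\<in>F. 1 < \<alpha> Q} = {Q\<in>F. 1 < \<alpha> Q \<and> \<alpha> Q \<le> 2 ^ n}" by auto
  then have "(\<Sum>Q\<in>{Q\<in>F. 1 < \<alpha> Q}. measure M Q) \<le> B * (\<Sum>k\<in>{0..<n}. (1/2) ^ k)"
    using ind[of n] by (simp add: sum_distrib_left)
  also have "\<dots> \<le> B * 2" using geometric_tail_le[of "1/2" 0 n] B0 by (intro mult_left_mono) auto
  finally show ?thesis by simp
qed

text \<open>Since \<open>F\<close> is finite, the positive values of \<open>\<alpha>\<close> are
  bounded below and finitely many bands exhaust them; cubes of value 0 contribute nothing. All large
  \<open>n\<close> are allowed because the case \<open>2 \<le> p\<close> also needs \<open>n\<close>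
  beyond its cut.\<close>

lemma partial_square_split:
  "\<exists>n0. \<forall>n\<ge>n0. \<forall>x. (\<Sum>Q\<in>{Q\<in>F. \<alpha> Q \<le> 1}. (\<alpha> Q)\<^sup>2 * indicat_real Q x) = partial_square 0 n x"
proof -
  define \<delta> where "\<delta> = Min (insert 1 (\<alpha> ` {Q\<in>F. 0 < \<alpha> Q}))"
  have \<delta>: "0 < \<delta>" "\<And>Q. Q \<in> F \<Longrightarrow> 0 < \<alpha> Q \<Longrightarrow> \<delta> \<le> \<alpha> Q"
    using finF by (auto simp: \<delta>_def)
  obtain n0 where n0: "(1/2) ^ n0 < \<delta>" using real_arch_pow_inv[OF \<delta>(1), of "1/2"] by auto
  have "(\<Sum>Q\<in>{Q\<in>F. \<alpha> Q \<le> 1}. (\<alpha> Q)\<^sup>2 * indicat_real Q x) = partial_square 0 n x" if "n0 \<le> n" for n x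
  proof -
    have pw: "(1/2::real) ^ n \<le> (1/2) ^ n0" using that by (intro power_decreasing) auto
    have "(\<Sum>Q\<in>{Q\<in>F. (1/2)^m < \<alpha> Q \<and> \<alpha> Q \<le> 1}. (\<alpha> Q)\<^sup>2 * indicat_real Q x) = partial_square 0 m x" for m
    proof (induction m)
      case 0
      have "{Q\<in>F. (1/2)^0 < \<alpha> Q \<and> \<alpha> Q \<le> 1} = {}" by auto
      then show ?case by (simp only:) (simp add: partial_square_def)
    next
      case (Suc m)
      have "0 < (1/2::real) ^ m" "(1/2::real) ^ m \<le> 1" by (auto simp: power_le_one)
      then have "(1/2)^Suc m < \<alpha> Q \<and> \<alpha> Q \<le> 1 \<longleftrightarrow> (1/2)^m < \<alpha> Q \<and> \<alpha> Q \<le> 1 \<or> (1/2) ^ Suc m < \<alpha> Q \<and> \<alpha> Q \<le> (1/2)^m" for Q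
        unfolding power_Suc by linarith
      then have eq: "{Q\<in>F. (1/2)^Suc m < \<alpha> Q \<and> \<alpha> Q \<le> 1} = {Q\<in>F. (1/2)^m < \<alpha> Q \<and> \<alpha> Q \<le> 1} \<union> lev m"
        unfolding lev_def by blast
      have "{Q\<in>F. (1/2)^m < \<alpha> Q \<and> \<alpha> Q \<le> 1} \<inter> lev m = {}" by (auto simp: lev_def)
      then show ?case unfolding eq using finF finite_lev Suc
        by (subst sum.union_disjoint) (auto simp: partial_square_def)
    qed
    then have "partial_square 0 n x = (\<Sum>Q\<in>{Q\<in>F. (1/2)^n < \<alpha> Q \<and> \<alpha> Q \<le> 1}. (\<alpha> Q)\<^sup>2 * indicat_real Q x)" by simp
    also have "\<dots> = (\<Sum>Q\<in>{Q\<in>F. \<alpha> Q \<le> 1}. (\<alpha> Q)\<^sup>2 * indicat_real Q x)"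
    proof (rule sum.mono_neutral_left)
      show "\<forall>Q\<in>{Q \<in> F. \<alpha> Q \<le> 1} - {Q \<in> F. (1 / 2) ^ n < \<alpha> Q \<and> \<alpha> Q \<le> 1}. (\<alpha> Q)\<^sup>2 * indicat_real Q x = 0"
      proof
        fix Q assume Q: "Q \<in> {Q \<in> F. \<alpha> Q \<le> 1} - {Q \<in> F. (1 / 2) ^ n < \<alpha> Q \<and> \<alpha> Q \<le> 1}"
        then have "Q \<in> F" "\<alpha> Q \<le> (1/2) ^ n" by auto
        then have "\<not> 0 < \<alpha> Q" using \<delta>(2)[of Q] n0 pw by linarith
        then have "\<alpha> Q = 0" using \<alpha>0[of Q] by linarith
        then show "(\<alpha> Q)\<^sup>2 * indicat_real Q x = 0" by simp
      qed
    qed (use finF in auto)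
    finally show ?thesis ..
  qed
  then show ?thesis by blast
qed

lemma partial_square_nonneg: "0 \<le> partial_square m n x"
  unfolding partial_square_def by (intro sum_nonneg) auto

lemma integrable_partial_square: "integrable M (partial_square m n)"
  unfolding partial_square_def[abs_def]
  using lev_subset integrable_indicator by (intro Bochner_Integration.integrable_sum integrable_mult_right) blast

lemma partial_square_append: "m \<le> n \<Longrightarrow> n \<le> l \<Longrightarrow> partial_square m l x = partial_square m n x + partial_square n l x"
  unfolding partial_square_def by (simp add: sum.atLeastLessThan_concat)

lemma lev_square_le:
  "Q \<in> lev k \<Longrightarrow> (\<alpha> Q)\<^sup>2 \<le> (1/4) ^ k"
proof -
  assume "Q \<in> lev k"
  then have "(\<alpha> Q)\<^sup>2 \<le> ((1/2) ^ k)\<^sup>2" using \<alpha>0 by (intro power_mono) (auto simp: lev_def)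
  also have "\<dots> = (1/4) ^ k" by (simp add: power2_eq_square flip: power_mult_distrib)
  finally show ?thesis .
qed

text \<open>Band \<open>k\<close> contributes the factor \<open>(1/4) ^ k\<close> times the growth
  \<open>(2 powr p) ^ k\<close> of its total measure. The resulting ratio
  \<open>2 powr (p - 2)\<close> is below 1 exactly when \<open>p < 2\<close>, which separates the
  two cases.\<close>

lemma integral_partial_square_le:
  "(\<integral>x. partial_square m n x \<partial>M) \<le> B * 2 powr p * (\<Sum>k\<in>{m..<n}. (2 powr (p - 2)) ^ k)"
proof -
  have "(\<integral>x. partial_square m n x \<partial>M) = (\<Sum>k\<in>{m..<n}. \<Sum>Q\<in>lev k. (\<alpha> Q)\<^sup>2 * measure M Q)"
  proof -
    have *: "\<And>Q k. Q \<in> lev k \<Longrightarrow> Q \<in> F" using lev_subset by blast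
    have sp: "Q \<inter> space M = Q" if "Q \<in> F" for Q
      using sets.sets_into_space[OF fmeasurableD[OF FM[OF that]]] by blast
    show ?thesis
      unfolding partial_square_def
      by (simp add: Bochner_Integration.integral_sum Bochner_Integration.integrable_sum
          integrable_indicator sp * cong: sum.cong)
  qed
  also have "\<dots> \<le> (\<Sum>k\<in>{m..<n}. (1/4)^k * (B * 2 powr p * (2 powr p) ^ k))"
  proof (rule sum_mono)
    fix k
    have "(\<Sum>Q\<in>lev k. (\<alpha> Q)\<^sup>2 * measure M Q) \<le> (\<Sum>Q\<in>lev k. (1/4)^k * measure M Q)"
      using lev_square_le by (intro sum_mono mult_right_mono) auto
    also have "\<dots> = (1/4)^k * (\<Sum>Q\<in>lev k. measure M Q)" by (simp add: sum_distrib_left)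
    also have "\<dots> \<le> (1/4)^k * (B * 2 powr p * (2 powr p) ^ k)"
      by (intro mult_left_mono sum_lev_le) auto
    finally show "(\<Sum>Q\<in>lev k. (\<alpha> Q)\<^sup>2 * measure M Q) \<le> (1/4)^k * (B * 2 powr p * (2 powr p) ^ k)" .
  qed
  also have "\<dots> = (\<Sum>k\<in>{m..<n}. B * 2 powr p * (2 powr (p - 2)) ^ k)"
  proof (rule sum.cong[OF refl])
    fix k
    have "(2::real) powr (p - 2) = 1/4 * 2 powr p" by (simp add: powr_diff)
    then show "(1/4)^k * (B * 2 powr p * (2 powr p) ^ k) = B * 2 powr p * (2 powr (p - 2)) ^ k"
      by (simp only: power_mult_distrib) simp
  qed
  finally show ?thesis by (simp add: sum_distrib_left)
qed

section \<open>Measure of the superlevel set by first and second moments\<close>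

definition super :: "'a set" where
  "super = {x \<in> space M. 1 < (\<Sum>Q\<in>F. (\<alpha> Q)\<^sup>2 * indicat_real Q x)}"

lemma sum_le_partial_square_or_large:
  assumes "x \<in> super"
    and n: "\<And>x. (\<Sum>Q\<in>{Q\<in>F. \<alpha> Q \<le> 1}. (\<alpha> Q)\<^sup>2 * indicat_real Q x) = partial_square 0 n x"
  shows "x \<in> \<Union>{Q\<in>F. 1 < \<alpha> Q} \<or> 1 < partial_square 0 n x"
proof (cases "x \<in> \<Union>{Q\<in>F. 1 < \<alpha> Q}")
  case False
  have "(\<Sum>Q\<in>{Q\<in>F. \<alpha> Q \<le> 1}. (\<alpha> Q)\<^sup>2 * indicat_real Q x) = (\<Sum>Q\<in>F. (\<alpha> Q)\<^sup>2 * indicat_real Q x)"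
  proof (rule sum.mono_neutral_left)
    show "\<forall>Q\<in>F - {Q\<in>F. \<alpha> Q \<le> 1}. (\<alpha> Q)\<^sup>2 * indicat_real Q x = 0"
      using False by (force simp: indicator_def)
  qed (use finF in auto)
  then show ?thesis using assms(1) n[of x] by (simp add: super_def)
qed simp

lemma super_sets: "super \<in> sets M"
proof -
  have "(\<lambda>x. \<Sum>Q\<in>F. (\<alpha> Q)\<^sup>2 * indicat_real Q x) \<in> borel_measurable M"
    using FM by (intro borel_measurable_sum borel_measurable_times borel_measurable_const borel_measurable_indicator fmeasurableD)
  then show ?thesis unfolding super_def by (intro borel_measurable_less borel_measurable_const)
qed

lemma large_union:
  "\<Union>{Q\<in>F. 1 < \<alpha> Q} \<in> fmeasurable M" "measure M (\<Union>{Q\<in>F. 1 < \<alpha> Q}) \<le> 2 * B"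
proof -
  show "\<Union>{Q\<in>F. 1 < \<alpha> Q} \<in> fmeasurable M" using finF FM by (intro fmeasurable.finite_Union) auto
  have "measure M (\<Union>Q\<in>{Q\<in>F. 1 < \<alpha> Q}. Q) \<le> (\<Sum>Q\<in>{Q\<in>F. 1 < \<alpha> Q}. measure M Q)"
    using finF FM by (intro measure_UNION_le) (auto simp: fmeasurable_def)
  also have "\<dots> \<le> 2 * B" by (rule large_le)
  finally show "measure M (\<Union>{Q\<in>F. 1 < \<alpha> Q}) \<le> 2 * B" by simp
qed

text \<open>The cubes with \<open>\<alpha> Q > 1\<close> give the 2 by the union bound; Markov's
  inequality and the convergent first moment series give the other term.\<close>

lemma measure_super_subcritical:
  assumes "p < 2"
  shows "super \<in> fmeasurable M" "measure M super \<le> (2 + 2 powr p / (1 - 2 powr (p - 2))) * B"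
proof -
  obtain n where n: "\<And>x. (\<Sum>Q\<in>{Q\<in>F. \<alpha> Q \<le> 1}. (\<alpha> Q)\<^sup>2 * indicat_real Q x) = partial_square 0 n x"
    using partial_square_split by blast
  let ?U = "\<Union>{Q\<in>F. 1 < \<alpha> Q}" and ?V = "{x \<in> space M. 1 < partial_square 0 n x}"
  have sub: "super \<subseteq> ?U \<union> ?V"
    using sum_le_partial_square_or_large[OF _ n] by (auto simp: super_def)
  note V = Markov_strict[OF integrable_partial_square partial_square_nonneg zero_less_one, of 0 n]
  have UV: "?U \<union> ?V \<in> fmeasurable M" using large_union(1) V(1) by (rule fmeasurable.Un)
  show "super \<in> fmeasurable M" by (rule fmeasurableI2[OF UV sub super_sets])
  have "2 powr (p - 2) < (2::real) powr 0" using assms by (intro powr_less_mono) auto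
  then have q: "2 powr (p - 2) < (1::real)" by simp
  have "measure M ?V \<le> (\<integral>x. partial_square 0 n x \<partial>M)" using V(2) by simp
  also have "\<dots> \<le> B * 2 powr p * (\<Sum>k\<in>{0..<n}. (2 powr (p - 2)) ^ k)" by (rule integral_partial_square_le)
  also have "\<dots> \<le> B * 2 powr p * (1 / (1 - 2 powr (p - 2)))"
    using geometric_tail_le[of "2 powr (p - 2)" 0 n] q B0 by (intro mult_left_mono) auto
  finally have V2: "measure M ?V \<le> B * 2 powr p * (1 / (1 - 2 powr (p - 2)))" .
  have "measure M super \<le> measure M (?U \<union> ?V)"
    by (rule measure_mono_fmeasurable[OF sub super_sets UV])
  also have "\<dots> \<le> measure M ?U + measure M ?V"
    using large_union(1) V(1) by (intro measure_Un_le) auto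
  also have "\<dots> \<le> 2 * B + B * 2 powr p * (1 / (1 - 2 powr (p - 2)))"
    using large_union(2) V2 by simp
  finally show "measure M super \<le> (2 + 2 powr p / (1 - 2 powr (p - 2))) * B" by (simp add: algebra_simps)
qed

text \<open>Cauchy-Schwarz over the bands with weights \<open>s ^ k\<close> leaves the ratio
  \<open>1 / (16 * s)\<close>, which the growth \<open>2 powr p\<close> of the band masses turns
  into \<open>q\<close>. The tail decays with ratio \<open>s * q = 2 powr (p - 4)\<close>.\<close>

lemma integral_partial_square_power2_le:
  assumes A: "0 \<le> c"
    and sq: "\<And>G. G \<subseteq> F \<Longrightarrow> (\<integral>x. (\<Sum>Q\<in>G. indicat_real Q x)\<^sup>2 \<partial>M) \<le> c * (\<Sum>Q\<in>G. measure M Q)"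
    and s: "0 < s" "s < 1" and q: "q = 2 powr p / (16 * s)" "q < 1"
  shows "integrable M (\<lambda>x. (partial_square m n x)\<^sup>2)"
    and "(\<integral>x. (partial_square m n x)\<^sup>2 \<partial>M) \<le> c * B * 2 powr p * (s * q) ^ m / ((1 - s) * (1 - q))"
proof -
  have F: "\<And>Q k. Q \<in> lev k \<Longrightarrow> Q \<in> F" using lev_subset by blast
  define b where "b k x = (\<Sum>Q\<in>lev k. indicat_real Q x)" for k x
  have b0: "0 \<le> b k x" for k x unfolding b_def by (intro sum_nonneg) auto
  have intprod: "integrable M (\<lambda>x. indicat_real Q x * indicat_real Q' x)" if "Q \<in> F" "Q' \<in> F" for Q Q'
  proof -
    have "Q \<inter> Q' \<in> fmeasurable M" using FM that by (intro fmeasurable.Int) auto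
    then have "integrable M (indicat_real (Q \<inter> Q'))" by (simp add: fmeasurable_def integrable_indicator_iff)
    moreover have "(\<lambda>x. indicat_real Q x * indicat_real Q' x) = indicat_real (Q \<inter> Q')"
      by (simp add: fun_eq_iff indicator_inter_arith)
    ultimately show ?thesis by simp
  qed
  have intb: "integrable M (\<lambda>x. (b k x)\<^sup>2)" for k
    unfolding b_def power2_eq_square sum_product
    using intprod F by (intro Bochner_Integration.integrable_sum) auto
  have bk: "(\<integral>x. (b k x)\<^sup>2 \<partial>M) \<le> c * (B * 2 powr p * (2 powr p) ^ k)" for k
  proof -
    have "(\<integral>x. (b k x)\<^sup>2 \<partial>M) \<le> c * (\<Sum>Q\<in>lev k. measure M Q)"
      unfolding b_def by (rule sq[OF lev_subset])
    also have "\<dots> \<le> c * (B * 2 powr p * (2 powr p) ^ k)"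
      using A by (intro mult_left_mono sum_lev_le)
    finally show ?thesis .
  qed
  have pw: "(partial_square m n x)\<^sup>2 \<le> s ^ m / (1 - s) * (\<Sum>k\<in>{m..<n}. (1 / (16 * s)) ^ k * (b k x)\<^sup>2)" for x
  proof -
    have "partial_square m n x \<le> (\<Sum>k\<in>{m..<n}. (1/4) ^ k * b k x)"
      unfolding partial_square_def b_def sum_distrib_left
      using lev_square_le by (intro sum_mono mult_right_mono) auto
    also have "\<dots> = (\<Sum>k\<in>{m..<n}. sqrt s ^ k * ((1 / (4 * sqrt s)) ^ k * b k x))"
    proof (rule sum.cong[OF refl])
      fix k
      have "(1/4::real) = sqrt s * (1 / (4 * sqrt s))" using s by simp
      then have "(1/4::real) ^ k = sqrt s ^ k * (1 / (4 * sqrt s)) ^ k" by (metis power_mult_distrib)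
      then show "(1/4) ^ k * b k x = sqrt s ^ k * ((1 / (4 * sqrt s)) ^ k * b k x)" by simp
    qed
    finally have "(partial_square m n x)\<^sup>2 \<le> (\<Sum>k\<in>{m..<n}. sqrt s ^ k * ((1 / (4 * sqrt s)) ^ k * b k x))\<^sup>2"
      using partial_square_nonneg by (intro power_mono)
    also have "\<dots> \<le> (\<Sum>k\<in>{m..<n}. (sqrt s ^ k)\<^sup>2) * (\<Sum>k\<in>{m..<n}. ((1 / (4 * sqrt s)) ^ k * b k x)\<^sup>2)"
      by (rule Cauchy_Schwarz_ineq_sum)
    also have "(\<Sum>k\<in>{m..<n}. (sqrt s ^ k)\<^sup>2) = (\<Sum>k\<in>{m..<n}. s ^ k)"
      using s by (intro sum.cong refl) (metis less_imp_le power_mult mult.commute real_sqrt_pow2)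
    also have "(\<Sum>k\<in>{m..<n}. ((1 / (4 * sqrt s)) ^ k * b k x)\<^sup>2) = (\<Sum>k\<in>{m..<n}. (1 / (16 * s)) ^ k * (b k x)\<^sup>2)"
    proof (rule sum.cong[OF refl])
      fix k
      have "(1 / (4 * sqrt s))\<^sup>2 = 1 / (16 * s)" using s by (simp add: power_divide power_mult_distrib)
      then have "((1 / (4 * sqrt s)) ^ k)\<^sup>2 = (1 / (16 * s)) ^ k" by (metis power_mult mult.commute)
      then show "((1 / (4 * sqrt s)) ^ k * b k x)\<^sup>2 = (1 / (16 * s)) ^ k * (b k x)\<^sup>2" by (simp only: power_mult_distrib)
    qed
    also have "(\<Sum>k\<in>{m..<n}. s ^ k) * (\<Sum>k\<in>{m..<n}. (1 / (16 * s)) ^ k * (b k x)\<^sup>2)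
        \<le> s ^ m / (1 - s) * (\<Sum>k\<in>{m..<n}. (1 / (16 * s)) ^ k * (b k x)\<^sup>2)"
      using s by (intro mult_right_mono geometric_tail_le sum_nonneg) auto
    finally show ?thesis .
  qed
  have intR: "integrable M (\<lambda>x. s ^ m / (1 - s) * (\<Sum>k\<in>{m..<n}. (1 / (16 * s)) ^ k * (b k x)\<^sup>2))"
    using intb by (intro integrable_mult_right Bochner_Integration.integrable_sum) auto
  show intT: "integrable M (\<lambda>x. (partial_square m n x)\<^sup>2)"
  proof (rule Bochner_Integration.integrable_bound[OF intR])
    show "(\<lambda>x. (partial_square m n x)\<^sup>2) \<in> borel_measurable M"
      using integrable_partial_square[of m n] by (intro borel_measurable_power) auto
    show "AE x in M. norm ((partial_square m n x)\<^sup>2) \<le> norm (s ^ m / (1 - s) * (\<Sum>k\<in>{m..<n}. (1 / (16 * s)) ^ k * (b k x)\<^sup>2))"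
      using order_trans[OF pw abs_ge_self] by (intro AE_I2) (simp only: real_norm_def abs_power2)
  qed
  have q0: "0 < q" using q s by simp
  have "(\<integral>x. (partial_square m n x)\<^sup>2 \<partial>M) \<le> (\<integral>x. s ^ m / (1 - s) * (\<Sum>k\<in>{m..<n}. (1 / (16 * s)) ^ k * (b k x)\<^sup>2) \<partial>M)"
    by (intro integral_mono intT intR pw)
  also have "\<dots> = s ^ m / (1 - s) * (\<Sum>k\<in>{m..<n}. (1 / (16 * s)) ^ k * (\<integral>x. (b k x)\<^sup>2 \<partial>M))"
    using intb by (simp add: Bochner_Integration.integral_sum)
  also have "\<dots> \<le> s ^ m / (1 - s) * (\<Sum>k\<in>{m..<n}. (1 / (16 * s)) ^ k * (c * (B * 2 powr p * (2 powr p) ^ k)))"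
    using s bk by (intro mult_left_mono sum_mono) auto
  also have "(\<Sum>k\<in>{m..<n}. (1 / (16 * s)) ^ k * (c * (B * 2 powr p * (2 powr p) ^ k))) = c * B * 2 powr p * (\<Sum>k\<in>{m..<n}. q ^ k)"
    unfolding q(1) by (simp add: sum_distrib_left power_divide mult_ac)
  also have "s ^ m / (1 - s) * (c * B * 2 powr p * (\<Sum>k\<in>{m..<n}. q ^ k)) \<le> s ^ m / (1 - s) * (c * B * 2 powr p * (q ^ m / (1 - q)))"
    using s q q0 A B0 by (intro mult_left_mono geometric_tail_le) auto
  also have "\<dots> = c * B * 2 powr p * (s * q) ^ m / ((1 - s) * (1 - q))"
    by (simp add: power_mult_distrib mult_ac)
  finally show "(\<integral>x. (partial_square m n x)\<^sup>2 \<partial>M) \<le> c * B * 2 powr p * (s * q) ^ m / ((1 - s) * (1 - q))" .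
qed

text \<open>The levels \<open>2 powr - k\<close> are split at \<open>4 ^ L \<le> A < 4 ^ (L + 1)\<close>: first moments
  control the levels up to \<open>L\<close>, second moments the remaining ones.\<close>
lemma measure_super_critical:
  assumes p2: "2 \<le> p" "p < 3" and A: "1 \<le> A" and c: "0 \<le> c"
    and sq: "\<And>G. G \<subseteq> F \<Longrightarrow> (\<integral>x. (\<Sum>Q\<in>G. indicat_real Q x)\<^sup>2 \<partial>M) \<le> c * A * (\<Sum>Q\<in>G. measure M Q)"
  shows "super \<in> fmeasurable M"
    and "measure M super \<le> (2 + 2 * 2 powr p + 4 * c * 2 powr p / ((1 - 2 powr (-1/2)) * (1 - 2 powr (p - 7/2))))
      * (1 + ln A) * A powr (p/2 - 1) * B"
proof -
  define L where "L = nat \<lfloor>log 4 A\<rfloor>"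
  have l0: "0 \<le> log 4 A" using A by simp
  have L1: "real L \<le> log 4 A" "log 4 A < real (Suc L)" using l0 unfolding L_def by linarith+
  have AL: "4 ^ L \<le> A" "A \<le> 4 ^ Suc L"
  proof -
    have "(4::real) powr L \<le> 4 powr (log 4 A)" using L1 by (intro powr_mono) auto
    then show "4 ^ L \<le> A" using A by (simp add: powr_realpow)
    have "(4::real) powr (log 4 A) \<le> 4 powr (Suc L)" using L1 by (intro powr_mono) auto
    then show "A \<le> 4 ^ Suc L" using A by (simp only: powr_realpow) simp
  qed
  \<comment> \<open>Since \<open>ln 4\<close> is at least 1, the number \<open>L + 1\<close> of low
    levels is at most \<open>1 + ln A\<close>; this is the source of the logarithm.\<close>
  have lnA: "real L \<le> ln A"
  proof -
    have "exp (1::real) \<le> 4" using exp_le by simp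
    then have ln4: "1 \<le> ln (4::real)" by (simp add: ln_ge_iff)
    have "real L \<le> real L * ln 4" using ln4 by (simp add: mult_le_cancel_left1)
    also have "\<dots> \<le> log 4 A * ln 4" using L1 ln4 by (intro mult_right_mono) auto
    also have "\<dots> = ln A" using ln4 by (simp add: log_def)
    finally show ?thesis .
  qed
  \<comment> \<open>This \<open>s\<close> keeps \<open>q\<close> below 1 for all
    \<open>p < 7/2\<close>, in particular in the present range.\<close>
  define s q where "s = (2::real) powr (-1/2)" and "q = (2::real) powr (p - 7/2)"
  have s: "0 < s" "s < 1" using powr_less_mono[of "-1/2" 0 "2::real"] by (auto simp: s_def)
  have q: "0 < q" "q < 1" using powr_less_mono[of "p - 7/2" 0 "2::real"] p2 by (auto simp: q_def)
  have "2 powr (p - 7/2) = 2 powr p / 2 powr (4 + - 1/2 :: real)" by (simp add: powr_diff[symmetric])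
  also have "(2::real) powr (4 + - 1/2) = 16 * 2 powr (- 1/2)" by (subst powr_add) simp
  finally have qs: "q = 2 powr p / (16 * s)" by (simp add: q_def s_def)
  \<comment> \<open>The exponent \<open>p/2 - 2\<close> is negative, so the bound
    \<open>A \<le> 4 ^ Suc L\<close> is the one that applies.\<close>
  have sq4: "(s * q) ^ Suc L \<le> A powr (p/2 - 2)"
  proof -
    have "s * q = 2 powr (p - 4)" by (simp add: s_def q_def powr_add[symmetric])
    then have "(s * q) ^ Suc L = 2 powr ((p - 4) * Suc L)" by (simp add: powr_realpow[symmetric] powr_powr del: of_nat_Suc power_Suc)
    also have "\<dots> = (4 ^ Suc L) powr (p/2 - 2)"
    proof -
      have "(4::real) ^ Suc L = 2 powr (2 * real (Suc L))" by (rule four_power)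
      then show ?thesis by (simp add: powr_powr algebra_simps del: of_nat_Suc power_Suc)
    qed
    also have "\<dots> \<le> A powr (p/2 - 2)"
      using AL A p2 by (intro powr_mono2') auto
    finally show ?thesis .
  qed
  obtain n0 where n0: "\<And>n x. n \<ge> n0 \<Longrightarrow> (\<Sum>Q\<in>{Q\<in>F. \<alpha> Q \<le> 1}. (\<alpha> Q)\<^sup>2 * indicat_real Q x) = partial_square 0 n x"
    using partial_square_split by blast
  define n where "n = max n0 (Suc L)"
  have n: "n0 \<le> n" "Suc L \<le> n" by (auto simp: n_def)
  \<comment> \<open>Off the large cubes, a sum above 1 has its low or its high part above 1/2;
    squaring the high part gives the threshold 1/4.\<close>
  let ?U = "\<Union>{Q\<in>F. 1 < \<alpha> Q}" and ?V = "{x \<in> space M. 1/2 < partial_square 0 (Suc L) x}"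
    and ?T = "{x \<in> space M. 1/4 < (partial_square (Suc L) n x)\<^sup>2}"
  have sub: "super \<subseteq> ?U \<union> (?V \<union> ?T)"
  proof
    fix x assume x: "x \<in> super"
    then have sp: "x \<in> space M" by (simp add: super_def)
    have "1/4 < (partial_square (Suc L) n x)\<^sup>2" if "1/2 < partial_square (Suc L) n x"
      using power_strict_mono[OF that, of 2] by (simp add: power2_eq_square)
    then show "x \<in> ?U \<union> (?V \<union> ?T)"
      using sum_le_partial_square_or_large[OF x n0[OF n(1)]] sp partial_square_append[of 0 "Suc L" n x] n
      by (auto simp del: power_Suc)
  qed
  note int2 = integral_partial_square_power2_le[OF mult_nonneg_nonneg[OF c] sq s qs q(2), of "Suc L" n]
  note V = Markov_strict[OF integrable_partial_square partial_square_nonneg half_gt_zero[OF zero_less_one], of 0 "Suc L"]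
  have A0: "0 \<le> A" using A by simp
  have q4: "(0::real) < 1/4" by simp
  note T = Markov_strict[OF int2(1)[OF A0] zero_le_power2 q4]
  have VT: "?V \<union> ?T \<in> fmeasurable M" using V(1) T(1) by (rule fmeasurable.Un)
  have UVT: "?U \<union> (?V \<union> ?T) \<in> fmeasurable M" using large_union(1) VT by (rule fmeasurable.Un)
  show "super \<in> fmeasurable M" by (rule fmeasurableI2[OF UVT sub super_sets])
  define X where "X = (1 + ln A) * A powr (p/2 - 1) * B"
  have lnA0: "0 \<le> ln A" using A by simp
  have Ap1: "1 \<le> A powr (p/2 - 1)" using A p2 by (simp add: ge_one_powr_ge_zero)
  have XB: "A powr (p/2 - 1) * B \<le> X" "B \<le> X"
  proof -
    show *: "A powr (p/2 - 1) * B \<le> X"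
      unfolding X_def using lnA0 B0 by (simp add: mult_right_mono algebra_simps)
    have "1 * B \<le> A powr (p/2 - 1) * B" using Ap1 B0 by (rule mult_right_mono)
    then show "B \<le> X" using * by simp
  qed
  have Vle: "measure M ?V \<le> 2 * 2 powr p * X"
  proof -
    \<comment> \<open>For \<open>k \<le> L\<close> one has \<open>4 ^ k \<le> A\<close>, and each
      summand is the power \<open>p/2 - 1\<close> of \<open>4 ^ k\<close>, monotone because
      \<open>2 \<le> p\<close>.\<close>
    have "(\<Sum>k\<in>{0..<Suc L}. (2 powr (p - 2)) ^ k) \<le> (\<Sum>k\<in>{0..<Suc L}. A powr (p/2 - 1))"
    proof (rule sum_mono)
      fix k assume "k \<in> {0..<Suc L}"
      then have "(4::real) ^ k \<le> 4 ^ L" by (intro power_increasing) auto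
      then have k: "4 ^ k \<le> A" using AL(1) by (rule order_trans)
      have "(2 powr (p - 2)) ^ k = (2::real) powr ((p - 2) * k)" by (simp add: powr_realpow[symmetric] powr_powr)
      also have "\<dots> = (4 ^ k) powr (p/2 - 1)"
      proof -
        have "(4::real) ^ k = 2 powr (2 * real k)" by (rule four_power)
        then show ?thesis by (simp add: powr_powr algebra_simps)
      qed
      also have "\<dots> \<le> A powr (p/2 - 1)" using k p2 by (intro powr_mono2) auto
      finally show "(2 powr (p - 2)) ^ k \<le> A powr (p/2 - 1)" .
    qed
    also have "(\<Sum>k\<in>{0..<Suc L}. A powr (p/2 - 1)) = (1 + real L) * A powr (p/2 - 1)" by simp
    also have "\<dots> \<le> (1 + ln A) * A powr (p/2 - 1)" using lnA by (intro mult_right_mono) auto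
    finally have le: "(\<Sum>k\<in>{0..<Suc L}. (2 powr (p - 2)) ^ k) \<le> (1 + ln A) * A powr (p/2 - 1)" .
    have "measure M ?V \<le> 2 * (\<integral>x. partial_square 0 (Suc L) x \<partial>M)" using V(2) by simp
    also have "\<dots> \<le> 2 * (B * 2 powr p * (\<Sum>k\<in>{0..<Suc L}. (2 powr (p - 2)) ^ k))"
      by (intro mult_left_mono integral_partial_square_le) auto
    also have "\<dots> \<le> 2 * (B * 2 powr p * ((1 + ln A) * A powr (p/2 - 1)))"
      using B0 by (intro mult_left_mono le) auto
    finally show ?thesis by (simp add: X_def mult_ac)
  qed
  \<comment> \<open>The factor \<open>A\<close> of the Carleson estimate times the decay
    \<open>A powr (p/2 - 2)\<close> of the tail matches the power from the low levels; the cut was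
    placed to achieve this.\<close>
  have Tle: "measure M ?T \<le> 4 * c * 2 powr p / ((1 - s) * (1 - q)) * X"
  proof -
    have "measure M ?T \<le> 4 * (\<integral>x. (partial_square (Suc L) n x)\<^sup>2 \<partial>M)" using T(2) by simp
    also have "\<dots> \<le> 4 * (c * A * B * 2 powr p * (s * q) ^ Suc L / ((1 - s) * (1 - q)))"
      using int2(2)[OF A0] by simp
    also have "\<dots> = 4 * c * 2 powr p / ((1 - s) * (1 - q)) * (A * (s * q) ^ Suc L * B)" by simp
    also have "\<dots> \<le> 4 * c * 2 powr p / ((1 - s) * (1 - q)) * (A * A powr (p/2 - 2) * B)"
      using sq4 A0 B0 c s q by (intro mult_left_mono mult_right_mono divide_nonneg_nonneg mult_nonneg_nonneg) auto
    also have "A * A powr (p/2 - 2) = A powr (p/2 - 1)"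
      using A powr_add[of A 1 "p/2 - 2"] by simp
    also have "4 * c * 2 powr p / ((1 - s) * (1 - q)) * (A powr (p/2 - 1) * B) \<le> 4 * c * 2 powr p / ((1 - s) * (1 - q)) * X"
      using XB c s q by (intro mult_left_mono divide_nonneg_nonneg mult_nonneg_nonneg) auto
    finally show ?thesis .
  qed
  have "measure M super \<le> measure M (?U \<union> (?V \<union> ?T))"
    by (rule measure_mono_fmeasurable[OF sub super_sets UVT])
  also have "\<dots> \<le> measure M ?U + measure M (?V \<union> ?T)"
    using large_union(1) VT by (intro measure_Un_le) auto
  also have "\<dots> \<le> measure M ?U + (measure M ?V + measure M ?T)"
    using V(1) T(1) by (intro add_left_mono measure_Un_le) auto
  also have "\<dots> \<le> 2 * X + (2 * 2 powr p * X + 4 * c * 2 powr p / ((1 - s) * (1 - q)) * X)"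
    using large_union(2) Vle Tle XB by (intro add_mono) auto
  also have "\<dots> = (2 + 2 * 2 powr p + 4 * c * 2 powr p / ((1 - s) * (1 - q))) * X" by (simp add: algebra_simps)
  finally show "measure M super \<le> (2 + 2 * 2 powr p + 4 * c * 2 powr p / ((1 - 2 powr (-1/2)) * (1 - 2 powr (p - 7/2))))
      * (1 + ln A) * A powr (p/2 - 1) * B"
    by (simp only: X_def s_def q_def mult.assoc)
qed

end

section \<open>The weak type estimate\<close>

definition superlevel :: "real \<Rightarrow> (real^'n \<Rightarrow> real) \<Rightarrow> (real^'n) set set \<Rightarrow> (real^'n) set" where
  "superlevel \<rho> f F = {x. 1 < (\<Sum>Q\<in>F. (avg (\<lambda>x. \<bar>f x\<bar>) (dilate \<rho> Q))\<^sup>2 * indicat_real Q x)}"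

text \<open>The constant is chosen before the weight, the function and the family. Its uniformity in
  \<open>F\<close> permits the later passage to infinite families.\<close>

lemma finite_sparse_estimate:
  fixes p \<rho> :: real
  assumes p1: "1 < p" and p3: "p < 3" and rho: "1 \<le> \<rho>"
  shows "\<exists>C\<ge>0. \<forall>(w :: real^'n \<Rightarrow> real) f (F :: (real^'n) set set).
      Ap_weight p w \<longrightarrow> in_Lp_w p w f \<longrightarrow> sparse F \<longrightarrow> finite F \<longrightarrow>
      superlevel \<rho> f F \<in> fmeasurable (wmeasure w) \<and>
      measure (wmeasure w) (superlevel \<rho> f F)
        \<le> C * (Ap_const p w powr (max (1/2) (1/p)) * phi p (Ap_const p w) * Lp_w_norm p w f) powr p"
proof -
  define K where "K = 2 powr p * overlap_const TYPE('n) \<rho>"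
  define c1 where "c1 = 2 + 2 powr p / (1 - 2 powr (p - 2))"
  define c2 where "c2 = 2 + 2 * 2 powr p + 4 * (2 * 2 powr p) * 2 powr p / ((1 - 2 powr (-1/2)) * (1 - 2 powr (p - 7/2)))"
  \<comment> \<open>One nonnegative constant serves both ranges: \<open>c1\<close> is meant for
    \<open>p < 2\<close> and is negative for \<open>p > 2\<close>, while \<open>c2\<close> is meant
    for \<open>2 \<le> p\<close>.\<close>
  have "0 \<le> K * max 0 (max c1 c2)" by (simp add: K_def)
  moreover
  have "superlevel \<rho> f F \<in> fmeasurable (wmeasure w) \<and>
      measure (wmeasure w) (superlevel \<rho> f F)
        \<le> K * max 0 (max c1 c2) * (Ap_const p w powr (max (1/2) (1/p)) * phi p (Ap_const p w) * Lp_w_norm p w f) powr p"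
    if Ap: "Ap_weight p w" and f: "in_Lp_w p w f" and F: "sparse F" "finite F"
    for w f :: "real^'n \<Rightarrow> real" and F
  proof -
    define A where "A = Ap_const p w"
    define N where "N = Lp_w_norm p w f"
    have A1: "1 \<le> A" unfolding A_def by (rule Ap_const_ge_1[OF p1 Ap])
    define B where "B = K * A * N powr p"
    have K0: "0 \<le> K" by (simp add: K_def)
    have B0: "0 \<le> B" using A1 K0 by (simp add: B_def)
    define \<alpha> where "\<alpha> = (\<lambda>Q. avg (\<lambda>x. \<bar>f x\<bar>) (dilate \<rho> Q))"
    interpret level_family "wmeasure w" F \<alpha> p B
    proof
      show "Q \<in> fmeasurable (wmeasure w)" if "Q \<in> F" for Q
        using F(1) that is_cube_dyadic by (intro cube_fmeasurable_wmeasure[OF Ap]) (auto simp: sparse_def)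
      show "0 \<le> \<alpha> Q" for Q
        unfolding \<alpha>_def avg_def set_lebesgue_integral_def by (intro divide_nonneg_nonneg integral_nonneg_AE) auto
      show "(\<Sum>Q\<in>G. measure (wmeasure w) Q) \<le> B * a powr (- p)"
        if "G \<subseteq> F" "0 < a" "\<And>Q. Q \<in> G \<Longrightarrow> a < \<alpha> Q \<and> \<alpha> Q \<le> 2 * a" for G a
        using level_sum[OF p1 rho Ap f sparse_subset[OF F(1) that(1)] finite_subset[OF that(1) F(2)] that(2)] that(3)
        by (simp add: \<alpha>_def B_def K_def A_def N_def)
    qed (use F p1 B0 in auto)
    have su: "super = superlevel \<rho> f F"
      unfolding super_def superlevel_def by (simp add: \<alpha>_def)
    have "super \<in> fmeasurable (wmeasure w) \<and> measure (wmeasure w) super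
        \<le> K * max 0 (max c1 c2) * (A powr (max (1/2) (1/p)) * phi p A * N) powr p"
    proof (cases "p < 2")
      case True
      have "max (1/2) (1/p) = 1/p" using True p1 by (simp add: max_def field_simps)
      then have eq: "(A powr (max (1/2) (1/p)) * phi p A * N) powr p = A * N powr p"
        using True p A1 by (simp add: phi_def powr_mult powr_powr)
      have "measure (wmeasure w) super \<le> c1 * B"
        using measure_super_subcritical(2)[OF True] by (simp add: c1_def)
      also have "\<dots> \<le> max 0 (max c1 c2) * B" using B0 by (intro mult_right_mono) auto
      finally show ?thesis using measure_super_subcritical(1)[OF True] unfolding eq by (simp add: B_def mult_ac)
    next
      case False
      then have p2: "2 \<le> p" by simp
      have mx: "max (1/2) (1/p) = 1/2" using p2 by (simp add: max_def field_simps)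
      have lnA: "0 \<le> ln A" using A1 by simp
      \<comment> \<open>The estimate above produces one logarithm, whereas the claim contains its
        p-th power; the base is at least 1.\<close>
      have "(1 + ln A) powr 1 \<le> (1 + ln A) powr p" using lnA p by (intro powr_mono) auto
      then have ln: "1 + ln A \<le> (1 + ln A) powr p" using lnA by simp
      have eq: "(A powr (max (1/2) (1/p)) * phi p A * N) powr p = (1 + ln A) powr p * A powr (p/2) * N powr p"
        unfolding mx using p2 A1 lnA by (simp add: phi_def powr_mult powr_powr)
      have sq: "(\<integral>x. (\<Sum>Q\<in>G. indicat_real Q x)\<^sup>2 \<partial>wmeasure w) \<le> 2 * 2 powr p * A * (\<Sum>Q\<in>G. measure (wmeasure w) Q)"
        if "G \<subseteq> F" for G
        unfolding A_def by (rule weighted_square_packing[OF p1 Ap sparse_subset[OF F(1) that] finite_subset[OF that F(2)]])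
      have "0 \<le> 2 * 2 powr p" by simp
      note ms = measure_super_critical[OF p2 p3 A1 this sq]
      have "measure (wmeasure w) super \<le> c2 * (1 + ln A) * A powr (p/2 - 1) * B"
        using ms(2) by (simp add: c2_def)
      also have "\<dots> = c2 * ((1 + ln A) * (K * (A * A powr (p/2 - 1)) * N powr p))" by (simp add: B_def)
      \<comment> \<open>One factor \<open>A\<close> comes from \<open>B\<close>; the result is the
        p-th power of \<open>A powr (1/2)\<close>.\<close>
      also have "A * A powr (p/2 - 1) = A powr (p/2)" using A1 powr_add[of A 1 "p/2 - 1"] by simp
      also have "c2 * ((1 + ln A) * (K * A powr (p/2) * N powr p)) \<le> max 0 (max c1 c2) * ((1 + ln A) powr p * (K * A powr (p/2) * N powr p))"
        using ln lnA K0 by (intro mult_mono) auto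
      finally show ?thesis using ms(1) unfolding eq by (simp add: mult_ac)
    qed
    then show ?thesis
      by (simp only: su A_def N_def)
  qed
  ultimately show ?thesis by blast
qed

section \<open>Rescaling and reduction to finite families\<close>

lemma in_Lp_w_divide:
  assumes f: "in_Lp_w p w f" and t: "0 < t" and p: "0 < p" and w: "w \<in> borel_measurable lebesgue"
  shows "in_Lp_w p w (\<lambda>x. f x / t)" and "Lp_w_norm p w (\<lambda>x. f x / t) = Lp_w_norm p w f / t"
proof -
  have [measurable]: "f \<in> borel_measurable lebesgue" "w \<in> borel_measurable lebesgue"
    using f w by (auto simp: in_Lp_w_def)
  have "(\<integral>\<^sup>+x. ennreal (\<bar>f x / t\<bar> powr p * w x) \<partial>lebesgue) = (\<integral>\<^sup>+x. ennreal (t powr (- p)) * ennreal (\<bar>f x\<bar> powr p * w x) \<partial>lebesgue)"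
    using t by (intro nn_integral_cong) (simp add: abs_divide powr_divide powr_minus field_simps flip: ennreal_mult')
  also have "\<dots> = ennreal (t powr (- p)) * (\<integral>\<^sup>+x. ennreal (\<bar>f x\<bar> powr p * w x) \<partial>lebesgue)"
    by (intro nn_integral_cmult) measurable
  finally have eq: "(\<integral>\<^sup>+x. ennreal (\<bar>f x / t\<bar> powr p * w x) \<partial>lebesgue) = ennreal (t powr (- p)) * (\<integral>\<^sup>+x. ennreal (\<bar>f x\<bar> powr p * w x) \<partial>lebesgue)" .
  show "in_Lp_w p w (\<lambda>x. f x / t)"
    using f unfolding in_Lp_w_def eq by (auto simp: ennreal_mult_less_top)
  have "(t powr (- p)) powr (1/p) = 1 / t"
  proof -
    have "(t powr (- p)) powr (1/p) = t powr (- 1)" using p by (simp add: powr_powr)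
    then show ?thesis using t by (simp add: powr_minus inverse_eq_divide)
  qed
  then show "Lp_w_norm p w (\<lambda>x. f x / t) = Lp_w_norm p w f / t"
    unfolding Lp_w_norm_def eq by (simp add: enn2real_mult powr_mult)
qed

lemma avg_divide: "avg (\<lambda>x. f x / t) R = avg f R / t"
  by (simp add: avg_def set_lebesgue_integral_def)

lemma abs_avg_le: "\<bar>avg f R\<bar> \<le> avg (\<lambda>x. \<bar>f x\<bar>) R"
proof -
  have "\<bar>LINT y:R|lebesgue. f y\<bar> \<le> (\<integral>y. norm (indicator R y *\<^sub>R f y) \<partial>lebesgue)"
    unfolding set_lebesgue_integral_def using integral_norm_bound[of lebesgue "\<lambda>y. indicator R y *\<^sub>R f y"] by simp
  also have "\<dots> = (LINT y:R|lebesgue. \<bar>f y\<bar>)"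
    unfolding set_lebesgue_integral_def by (intro Bochner_Integration.integral_cong) (auto simp: indicator_def)
  finally show ?thesis by (simp add: avg_def abs_divide divide_right_mono)
qed

text \<open>A sum of nonnegative extended reals is the supremum of its finite partial sums, so
  strict excess over \<open>t\<close> is witnessed by finitely many cubes. The witness depends on
  \<open>x\<close>.\<close>

lemma sparse_square_gt_finite:
  assumes gt: "ennreal t < sparse_square S \<rho> f x" and t: "0 < t"
  obtains F where "finite F" "F \<subseteq> S"
    "1 < (\<Sum>Q\<in>F. (avg (\<lambda>x. \<bar>f x / t\<bar>) (dilate \<rho> Q))\<^sup>2 * indicat_real Q x)"
proof -
  let ?g = "\<lambda>Q. (avg f (dilate \<rho> Q))\<^sup>2 * indicat_real Q x"
  let ?X = "\<Sum>\<^sub>\<infinity>Q\<in>S. ennreal (?g Q)"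
  have "ennreal (t\<^sup>2) < ?X"
  proof (cases "?X = \<infinity>")
    case False
    then have "t < enn2real ?X powr (1/2)"
      using gt t by (auto simp: sparse_square_def enn_powr_def ennreal_less_iff)
    then have "t\<^sup>2 < (enn2real ?X powr (1/2))\<^sup>2" using t by (intro power_strict_mono) auto
    also have "\<dots> = enn2real ?X" by (simp add: powr_half_sqrt)
    finally have "ennreal (t\<^sup>2) < ennreal (enn2real ?X)" by (simp add: ennreal_less_iff)
    also have "\<dots> = ?X" using False by (simp add: less_top)
    finally show ?thesis .
  qed simp
  also have "?X = (SUP F\<in>{F. finite F \<and> F \<subseteq> S}. \<Sum>Q\<in>F. ennreal (?g Q))"
    by (intro nonneg_infsum_complete) auto
  finally obtain F where F: "finite F" "F \<subseteq> S" "ennreal (t\<^sup>2) < (\<Sum>Q\<in>F. ennreal (?g Q))"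
    by (auto simp: less_SUP_iff)
  have "(\<Sum>Q\<in>F. ennreal (?g Q)) = ennreal (\<Sum>Q\<in>F. ?g Q)" by (rule sum_ennreal) auto
  then have "t\<^sup>2 < (\<Sum>Q\<in>F. ?g Q)" using F(3) by (simp add: ennreal_less_iff)
  then have "1 < (\<Sum>Q\<in>F. ?g Q) / t\<^sup>2" using t by simp
  also have "\<dots> = (\<Sum>Q\<in>F. (avg (\<lambda>x. f x / t) (dilate \<rho> Q))\<^sup>2 * indicat_real Q x)"
    by (simp add: avg_divide sum_divide_distrib power_divide)
  also have "\<dots> \<le> (\<Sum>Q\<in>F. (avg (\<lambda>x. \<bar>f x / t\<bar>) (dilate \<rho> Q))\<^sup>2 * indicat_real Q x)"
    by (intro sum_mono mult_right_mono) (metis abs_avg_le abs_ge_zero power2_abs power_mono, simp)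
  finally show thesis using F that by blast
qed

theorem theorem2p1:
  fixes p \<rho> :: real
  assumes "1 < p" and "p < 3" and "1 \<le> \<rho>"
  shows "\<exists>C. \<forall>(w :: real^'n \<Rightarrow> real) (S :: (real^'n) set set) f.
           Ap_weight p w \<longrightarrow> sparse S \<longrightarrow> in_Lp_w p w f \<longrightarrow>
           weak_Lp_w_norm p w (sparse_square S \<rho> f)
             \<le> ennreal (C * Ap_const p w powr (max (1/2) (1/p)) * phi p (Ap_const p w)
                         * Lp_w_norm p w f)"
proof -
  obtain C where C0: "0 \<le> C" and C: "\<And>(w :: real^'n \<Rightarrow> real) f (F :: (real^'n) set set).
      Ap_weight p w \<Longrightarrow> in_Lp_w p w f \<Longrightarrow> sparse F \<Longrightarrow> finite F \<Longrightarrow>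
      superlevel \<rho> f F \<in> fmeasurable (wmeasure w) \<and>
      measure (wmeasure w) (superlevel \<rho> f F)
        \<le> C * (Ap_const p w powr (max (1/2) (1/p)) * phi p (Ap_const p w) * Lp_w_norm p w f) powr p"
    using finite_sparse_estimate[OF assms, where 'n='n] by blast
  have "ennreal t * enn_powr (wmeas w {x. ennreal t < sparse_square S \<rho> f x}) (1/p)
      \<le> ennreal (C powr (1/p) * Ap_const p w powr (max (1/2) (1/p)) * phi p (Ap_const p w) * Lp_w_norm p w f)"
    if Ap: "Ap_weight p w" and S: "sparse S" and f: "in_Lp_w p w f" and t: "0 < t"
    for w f :: "real^'n \<Rightarrow> real" and S t
  proof -
    \<comment> \<open>By homogeneity, height \<open>t\<close> for \<open>f\<close> becomes height 1
      for \<open>g\<close>.\<close>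
    define g where "g = (\<lambda>x. f x / t)"
    have w: "w \<in> borel_measurable lebesgue" using Ap by (simp add: Ap_weight_def)
    have g: "in_Lp_w p w g" "Lp_w_norm p w g = Lp_w_norm p w f / t"
      using in_Lp_w_divide[OF f t _ w] assms(1) by (auto simp: g_def)
    define Y where "Y = Ap_const p w powr (max (1/2) (1/p)) * phi p (Ap_const p w) * Lp_w_norm p w g"
    have A1: "1 \<le> Ap_const p w" by (rule Ap_const_ge_1[OF assms(1) Ap])
    have Y0: "0 \<le> Y" using A1 by (simp add: Y_def phi_def Lp_w_norm_def)
    define D where "D F = superlevel \<rho> g F" for F
    have D: "D F \<in> fmeasurable (wmeasure w)" "emeasure (wmeasure w) (D F) \<le> ennreal (C * Y powr p)" if "F \<subseteq> S" "finite F" for F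
    proof -
      note CF = C[OF Ap g(1) sparse_subset[OF S that(1)] that(2), folded D_def Y_def]
      show *: "D F \<in> fmeasurable (wmeasure w)" using CF by (rule conjunct1)
      have "emeasure (wmeasure w) (D F) = ennreal (measure (wmeasure w) (D F))"
        using * by (rule emeasure_eq_measure2)
      also have "\<dots> \<le> ennreal (C * Y powr p)" using CF by (intro ennreal_leI) (rule conjunct2)
      finally show "emeasure (wmeasure w) (D F) \<le> ennreal (C * Y powr p)" .
    qed
    \<comment> \<open>An increasing exhaustion of the countable family \<open>S\<close> by finite
      ones: every pointwise finite witness lies in some \<open>e k\<close>.\<close>
    define e where "e k = {Q\<in>S. to_nat_on S Q < k}" for k
    have fin: "finite (e k)" "e k \<subseteq> S" for k
    proof -
      have "inj_on (to_nat_on S) (e k)"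
        using inj_on_to_nat_on[OF countable_sparse[OF S]] by (rule inj_on_subset) (auto simp: e_def)
      moreover have "to_nat_on S ` e k \<subseteq> {..<k}" by (auto simp: e_def)
      ultimately show "finite (e k)" by (meson finite_lessThan inj_on_finite)
    qed (auto simp: e_def)
    have Dmono: "D F \<subseteq> D G" if "F \<subseteq> G" "finite G" for F G
      unfolding D_def superlevel_def by (intro Collect_mono impI) (erule less_le_trans, intro sum_mono2 that, simp)
    have inc: "incseq (\<lambda>k. D (e k))"
      by (intro monoI Dmono fin) (auto simp: e_def)
    have "{x. ennreal t < sparse_square S \<rho> f x} \<subseteq> (\<Union>k. D (e k))"
    proof
      fix x assume "x \<in> {x. ennreal t < sparse_square S \<rho> f x}"
      then have gt: "ennreal t < sparse_square S \<rho> f x" by simp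
      obtain F where F: "finite F" "F \<subseteq> S"
        "1 < (\<Sum>Q\<in>F. (avg (\<lambda>x. \<bar>f x / t\<bar>) (dilate \<rho> Q))\<^sup>2 * indicat_real Q x)"
        by (rule sparse_square_gt_finite[OF gt t])
      then have xD: "x \<in> D F" by (simp add: D_def superlevel_def g_def)
      have "F \<subseteq> e (Suc (Max (insert 0 (to_nat_on S ` F))))"
        using F by (auto simp: e_def less_Suc_eq_le)
      then show "x \<in> (\<Union>k. D (e k))" using Dmono[OF _ fin(1)] xD by blast
    qed
    \<comment> \<open>\<open>wmeas\<close> is a nonnegative integral and monotone on arbitrary sets,
      so measurability is only used for the sets \<open>D (e k)\<close>.\<close>
    then have "wmeas w {x. ennreal t < sparse_square S \<rho> f x} \<le> wmeas w (\<Union>k. D (e k))"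
      unfolding wmeas_def by (intro nn_integral_mono mult_right_mono) (auto simp: indicator_def)
    also have "\<dots> = emeasure (wmeasure w) (\<Union>k. D (e k))"
      using fmeasurableD[OF D(1)[OF fin(2,1)]] by (intro emeasure_wmeasure[symmetric] w sets.countable_UN) auto
    also have "\<dots> = (SUP k. emeasure (wmeasure w) (D (e k)))"
      using fmeasurableD[OF D(1)[OF fin(2,1)]] inc by (intro SUP_emeasure_incseq[symmetric]) auto
    also have "\<dots> \<le> ennreal (C * Y powr p)"
      using D(2)[OF fin(2,1)] by (intro SUP_least)
    finally have le: "wmeas w {x. ennreal t < sparse_square S \<rho> f x} \<le> ennreal (C * Y powr p)" .
    \<comment> \<open>The finite bound excludes the infinite branch of
      \<open>enn_powr\<close>.\<close>
    have "enn_powr (wmeas w {x. ennreal t < sparse_square S \<rho> f x}) (1/p) \<le> ennreal ((C * Y powr p) powr (1/p))"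
      using le C0 assms(1) by (auto simp: enn_powr_def top_unique intro!: ennreal_leI powr_mono2 enn2real_leI)
    also have "(C * Y powr p) powr (1/p) = C powr (1/p) * Y"
      using C0 Y0 assms(1) by (simp add: powr_mult powr_powr)
    finally have "ennreal t * enn_powr (wmeas w {x. ennreal t < sparse_square S \<rho> f x}) (1/p) \<le> ennreal t * ennreal (C powr (1/p) * Y)"
      by (rule mult_left_mono) simp
    also have "\<dots> = ennreal (t * (C powr (1/p) * Y))" using t by (simp add: ennreal_mult')
    \<comment> \<open>The factor \<open>t\<close> cancels the \<open>1 / t\<close> in the norm of
      \<open>g\<close>.\<close>
    also have "t * (C powr (1/p) * Y) = C powr (1/p) * Ap_const p w powr (max (1/2) (1/p)) * phi p (Ap_const p w) * Lp_w_norm p w f"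
      using t by (simp add: Y_def g(2))
    finally show ?thesis .
  qed
  then show ?thesis
    unfolding weak_Lp_w_norm_def by (intro exI[of _ "C powr (1/p)"] allI impI SUP_least) auto
qed

end
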